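(* For all positive integers $n$, the immaculate algebra $$\mathbb{C}\mathcal{I}_n = \bigoplus_{\alpha \vDash n} \mathcal{M}_{g^{\alpha}}(\mathbb{C})$$ contains an isomorphic copy of the group algebra $\mathbb{C}S_n$ of the symmetric group $S_n$; that is, $\mathbb{C}\mathcal{I}_n$ has a subalgebra isomorphic to $\mathbb{C}S_n$ as a $\mathbb{C}$-algebra.
   Context: $\mathcal{M}_m(\mathbb{C})$ denotes the algebra of $m \times m$ complex matrices. A composition $\alpha = (\alpha_1, \ldots, \alpha_{\ell(\alpha)})$ of a positive integer $n$, written $\alpha \vDash n$, is a finite tuple of positive integers with sum $n$. The diagram of $\alpha$ has $\ell(\alpha)$ left-justified rows, the $i$-th row having $\alpha_i$ cells. A standard immaculate tableau of shape $\alpha \vDash n$ is a filling of the cells of this diagram with the labels $1, 2, \ldots, n$, each used exactly once, such that each row is increasing when read from left to right and the first (leftmost) column is strictly increasing when read from the first row to the last row (no condition is imposed on the other columns). The number of standard immaculate tableaux of shape $\alpha$ is denoted $g^{\alpha}$. The direct sum is over all compositions of $n$, with componentwise operations. A subalgebra is a linear subspace closed under multiplication; it is not required to contain the identity element of the ambient algebra. *)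

theory Defs
  imports
    "Jordan_Normal_Form.VS_Connect"
    "HOL-Algebra.Sym_Groups"
begin

subsection \<open>Compositions and standard immaculate tableaux\<close>

definition compositions :: "nat \<Rightarrow> nat list set" where
  "compositions n = {\<alpha>. (\<forall>a \<in> set \<alpha>. 0 < a) \<and> sum_list \<alpha> = n}"

text \<open>Rows and columns are indexed from 0: the cell \<open>(i, j)\<close> lies in row \<open>i\<close> and column \<open>j\<close>.\<close>

definition diagram :: "nat list \<Rightarrow> (nat \<times> nat) set" where
  "diagram \<alpha> = {(i, j). i < length \<alpha> \<and> j < \<alpha> ! i}"

text \<open>A filling is a function on cells; it is taken to be \<open>undefined\<close> off the diagram, so that
  distinct fillings are distinct functions and can be counted.\<close>

definition standard_immaculate_tableaux :: "nat list \<Rightarrow> (nat \<times> nat \<Rightarrow> nat) set" where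
  "standard_immaculate_tableaux \<alpha> =
    {T \<in> extensional (diagram \<alpha>).
       bij_betw T (diagram \<alpha>) {1..sum_list \<alpha>} \<and>
       (\<forall>i j j'. (i, j) \<in> diagram \<alpha> \<longrightarrow> (i, j') \<in> diagram \<alpha> \<longrightarrow> j < j' \<longrightarrow> T (i, j) < T (i, j')) \<and>
       (\<forall>i i'. (i, 0) \<in> diagram \<alpha> \<longrightarrow> (i', 0) \<in> diagram \<alpha> \<longrightarrow> i < i' \<longrightarrow> T (i, 0) < T (i', 0))}"

definition immaculate_number :: "nat list \<Rightarrow> nat" where
  "immaculate_number \<alpha> = card (standard_immaculate_tableaux \<alpha>)"

subsection \<open>Algebras\<close>

text \<open>The record type \<^typ>\<open>(complex, 'a) module\<close> carries the operations of a complex algebra: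
  those of a ring together with a scalar multiplication. (The library locale \<open>algebra\<close> is not used
  because it requires the multiplication to be commutative.)

  The componentwise direct sum below consists of all families indexed by \<open>I\<close>, hence is the direct
  sum for finite \<open>I\<close> only.\<close>

definition algebra_direct_sum :: "'i set \<Rightarrow> ('i \<Rightarrow> ('k, 'a) module) \<Rightarrow> ('k, 'i \<Rightarrow> 'a) module" where
  "algebra_direct_sum I A = \<lparr>
     carrier = (\<Pi>\<^sub>E i\<in>I. carrier (A i)),
     monoid.mult = (\<lambda>x y. \<lambda>i\<in>I. x i \<otimes>\<^bsub>A i\<^esub> y i),
     one = (\<lambda>i\<in>I. \<one>\<^bsub>A i\<^esub>),
     zero = (\<lambda>i\<in>I. \<zero>\<^bsub>A i\<^esub>),
     add = (\<lambda>x y. \<lambda>i\<in>I. x i \<oplus>\<^bsub>A i\<^esub> y i),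
     module.smult = (\<lambda>c x. \<lambda>i\<in>I. c \<odot>\<^bsub>A i\<^esub> x i)\<rparr>"

definition immaculate_algebra :: "nat \<Rightarrow> (complex, nat list \<Rightarrow> complex mat) module" where
  "immaculate_algebra n =
     algebra_direct_sum (compositions n)
       (\<lambda>\<alpha>. module_mat TYPE(complex) (immaculate_number \<alpha>) (immaculate_number \<alpha>))"

text \<open>An element of the group algebra, a formal linear combination of elements of \<open>G\<close>, is
  represented by its finitely supported coefficient function.\<close>

definition group_algebra :: "('g, 'm) monoid_scheme \<Rightarrow> (complex, 'g \<Rightarrow> complex) module" where
  "group_algebra G = \<lparr>
     carrier = {a. finite {g. a g \<noteq> 0} \<and> {g. a g \<noteq> 0} \<subseteq> carrier G},
     monoid.mult = (\<lambda>a b x. \<Sum>(g, h) \<in> {(g, h). a g \<noteq> 0 \<and> b h \<noteq> 0 \<and> g \<otimes>\<^bsub>G\<^esub> h = x}. a g * b h),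
     one = (\<lambda>x. if x = \<one>\<^bsub>G\<^esub> then 1 else 0),
     zero = (\<lambda>x. 0),
     add = (\<lambda>a b x. a x + b x),
     module.smult = (\<lambda>c a x. c * a x)\<rparr>"

text \<open>A subalgebra is not required to contain \<open>\<one>\<^bsub>A\<^esub>\<close>.\<close>

definition subalgebra :: "'a set \<Rightarrow> (complex, 'a) module \<Rightarrow> bool" where
  "subalgebra S A \<longleftrightarrow>
     VectorSpace.subspace class_ring S A \<and> (\<forall>x \<in> S. \<forall>y \<in> S. x \<otimes>\<^bsub>A\<^esub> y \<in> S)"

text \<open>Preservation of units is not part of the following definition because the unit field of
  \<open>A\<lparr>carrier := S\<rparr>\<close> need not be the unit of a subalgebra \<open>S\<close>. Nothing is lost: a multiplicative
  bijection maps a unit element to a unit element.\<close>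

definition algebra_isomorphic :: "(complex, 'a) module \<Rightarrow> (complex, 'b) module \<Rightarrow> bool" where
  "algebra_isomorphic A B \<longleftrightarrow>
     (\<exists>f. bij_betw f (carrier A) (carrier B) \<and>
          (\<forall>x \<in> carrier A. \<forall>y \<in> carrier A. f (x \<oplus>\<^bsub>A\<^esub> y) = f x \<oplus>\<^bsub>B\<^esub> f y) \<and>
          (\<forall>x \<in> carrier A. \<forall>y \<in> carrier A. f (x \<otimes>\<^bsub>A\<^esub> y) = f x \<otimes>\<^bsub>B\<^esub> f y) \<and>
          (\<forall>c. \<forall>x \<in> carrier A. f (c \<odot>\<^bsub>A\<^esub> x) = c \<odot>\<^bsub>B\<^esub> f x))"

subsection \<open>Basic facts\<close>

lemma finite_compositions: "finite (compositions n)"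
proof (rule finite_subset)
  show "compositions n \<subseteq> {xs. set xs \<subseteq> {..n} \<and> length xs \<le> n}"
  proof
    fix \<alpha> assume "\<alpha> \<in> compositions n"
    then have pos: "\<forall>a \<in> set \<alpha>. 0 < a" and s: "sum_list \<alpha> = n"
      by (auto simp: compositions_def)
    from pos have "length \<alpha> \<le> sum_list \<alpha>"
      by (induction \<alpha>) (auto simp: Suc_le_eq)
    with s show "\<alpha> \<in> {xs. set xs \<subseteq> {..n} \<and> length xs \<le> n}"
      using member_le_sum_list[of _ \<alpha>] by auto
  qed
  show "finite {xs. set xs \<subseteq> {..n} \<and> length xs \<le> n}"
    by (rule finite_lists_length_le) simp
qed

lemma finite_diagram: "finite (diagram \<alpha>)"
proof -
  have "diagram \<alpha> = (SIGMA i:{..<length \<alpha>}. {..<\<alpha> ! i})"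
    by (auto simp: diagram_def)
  then show ?thesis by simp
qed

lemma finite_standard_immaculate_tableaux: "finite (standard_immaculate_tableaux \<alpha>)"
proof (rule finite_subset)
  show "standard_immaculate_tableaux \<alpha> \<subseteq> (\<Pi>\<^sub>E c\<in>diagram \<alpha>. {1..sum_list \<alpha>})"
    unfolding standard_immaculate_tableaux_def PiE_def
    by (blast dest: bij_betwE)
  show "finite (\<Pi>\<^sub>E c\<in>diagram \<alpha>. {1..sum_list \<alpha>})"
    by (intro finite_PiE finite_diagram) simp
qed

lemma ring_algebra_direct_sum:
  assumes "\<And>i. i \<in> I \<Longrightarrow> ring (A i)"
  shows "ring (algebra_direct_sum I A)"
proof -
  have R: "ring (A i)" if "i \<in> I" for i
    using assms that by blast
  note simps = algebra_direct_sum_def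
  have "abelian_group (algebra_direct_sum I A)"
  proof (rule abelian_groupI)
    fix x assume "x \<in> carrier (algebra_direct_sum I A)"
    then show "\<exists>y\<in>carrier (algebra_direct_sum I A).
        y \<oplus>\<^bsub>algebra_direct_sum I A\<^esub> x = \<zero>\<^bsub>algebra_direct_sum I A\<^esub>"
      by (intro bexI[of _ "\<lambda>i\<in>I. \<ominus>\<^bsub>A i\<^esub> x i"])
        (auto simp: simps PiE_iff extensional_def restrict_def fun_eq_iff
          intro!: abelian_group.l_neg abelian_group.a_inv_closed ring.is_abelian_group R)
  qed (auto simp: simps PiE_iff extensional_def restrict_def fun_eq_iff
      intro!: abelian_monoid.a_closed abelian_monoid.zero_closed abelian_monoid.a_assoc
        abelian_monoid.a_comm abelian_monoid.l_zero abelian_group.axioms(1) ring.is_abelian_group R)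
  moreover have "Group.monoid (algebra_direct_sum I A)"
    by (rule monoidI)
      (auto simp: simps PiE_iff extensional_def restrict_def fun_eq_iff
        intro!: monoid.m_closed monoid.one_closed monoid.m_assoc monoid.l_one monoid.r_one
          ring.is_monoid R)
  ultimately show ?thesis
    by (rule ringI)
      (auto simp: simps PiE_iff extensional_def restrict_def fun_eq_iff
        intro!: ring.ring_simprules R)
qed

lemma vectorspace_algebra_direct_sum:
  assumes "field K" and "\<And>i. i \<in> I \<Longrightarrow> ring (A i)" and "\<And>i. i \<in> I \<Longrightarrow> module K (A i)"
  shows "vectorspace K (algebra_direct_sum I A)"
proof -
  have M: "module K (A i)" if "i \<in> I" for i
    using assms that by blast
  have "module K (algebra_direct_sum I A)"
  proof (rule moduleI)
    show "cring K" using assms(1) by (simp add: field_def domain_def)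
    show "abelian_group (algebra_direct_sum I A)"
      using ring_algebra_direct_sum[of I A] assms(2) by (simp add: ring.is_abelian_group)
  qed (auto simp: algebra_direct_sum_def PiE_iff extensional_def restrict_def fun_eq_iff
      intro!: module.smult_closed module.smult_l_distr module.smult_r_distr
        module.smult_assoc1 module.smult_one M)
  then show ?thesis
    using assms(1) by (simp add: vectorspace_def)
qed

lemma ring_module_mat: "ring (module_mat TYPE('a :: comm_ring_1) m m)"
  by (rule ringI, rule abelian_groupI)
    (auto simp: module_mat_def add_mult_distrib_mat mult_add_distrib_mat
      intro!: monoidI comm_add_mat bexI[of _ "- _"])

lemma ring_immaculate_algebra: "ring (immaculate_algebra n)"
  unfolding immaculate_algebra_def
  by (intro ring_algebra_direct_sum ring_module_mat)

lemma vectorspace_immaculate_algebra: "vectorspace class_ring (immaculate_algebra n)"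
  unfolding immaculate_algebra_def
  by (intro vectorspace_algebra_direct_sum ring_module_mat class_field
    vectorspace.axioms(1) matrix_vs)

lemma group_algebra_mult_eq_convolution:
  assumes "Group.group G" "finite (carrier G)"
    and "a \<in> carrier (group_algebra G)" "b \<in> carrier (group_algebra G)" "x \<in> carrier G"
  shows "(a \<otimes>\<^bsub>group_algebra G\<^esub> b) x = (\<Sum>g \<in> carrier G. a g * b (inv\<^bsub>G\<^esub> g \<otimes>\<^bsub>G\<^esub> x))"
proof -
  interpret G: Group.group G by fact
  let ?P = "{(g, h). a g \<noteq> 0 \<and> b h \<noteq> 0 \<and> g \<otimes>\<^bsub>G\<^esub> h = x}"
  let ?S = "{g \<in> carrier G. a g \<noteq> 0 \<and> b (inv\<^bsub>G\<^esub> g \<otimes>\<^bsub>G\<^esub> x) \<noteq> 0}"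
  have a: "a g \<noteq> 0 \<Longrightarrow> g \<in> carrier G" and b: "b g \<noteq> 0 \<Longrightarrow> g \<in> carrier G" for g
    using assms(3,4) by (auto simp: group_algebra_def)
  have inv_solve: "h = inv\<^bsub>G\<^esub> g \<otimes>\<^bsub>G\<^esub> x" if "a g \<noteq> 0" "b h \<noteq> 0" "g \<otimes>\<^bsub>G\<^esub> h = x" for g h
    using G.inv_solve_left[of h g x] a[OF that(1)] b[OF that(2)] that(3) assms(5) by simp
  have "(\<Sum>(g, h) \<in> ?P. a g * b h) = (\<Sum>g \<in> ?S. a g * b (inv\<^bsub>G\<^esub> g \<otimes>\<^bsub>G\<^esub> x))"
    by (rule sum.reindex_bij_witness[of _ "\<lambda>g. (g, inv\<^bsub>G\<^esub> g \<otimes>\<^bsub>G\<^esub> x)" fst])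
      (auto simp: inv_solve[symmetric] a b G.m_assoc[symmetric] assms(5))
  also have "\<dots> = (\<Sum>g \<in> carrier G. a g * b (inv\<^bsub>G\<^esub> g \<otimes>\<^bsub>G\<^esub> x))"
    using assms(2) by (intro sum.mono_neutral_left) auto
  finally show ?thesis
    by (simp add: group_algebra_def)
qed

end

theory Submission
  imports Defs "HOL-Library.Poly_Mapping" "HOL-Combinatorics.Orbits"
begin

text \<open>
  For a partition \<open>\<alpha>\<close> of \<open>n\<close>, let \<open>A\<close> be the signed sum of the row stabilizer and \<open>S\<close> the plain
  sum of the column stabilizer of a fixed labelling of the diagram of \<open>\<alpha>\<close>. The left ideal \<open>L\<close>
  generated by \<open>young \<alpha> = A * S\<close> is a copy of the Specht module, up to conjugating the shape. The
  proof has two halves: \<open>L\<close> has dimension at most \<open>g\<^sup>\<alpha>\<close>, and the ideals \<open>L\<close> for all partitions of \<open>n\<close>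
  together form a faithful module. A module of dimension at most \<open>m\<close> yields a multiplicative
  linear map into the \<open>m \<times> m\<close> matrices (choose a basis and pad with zeros, which sends 1 to
  an idempotent). Blocks of compositions that are not weakly decreasing receive zero.
  The resulting map into the immaculate algebra is injective by faithfulness, and its range is the
  required subalgebra.

  \<^bold>\<open>Dimension\<close> (\<open>straightening\<close>). The elements \<open>\<delta> h * young \<alpha>\<close> span \<open>L\<close>, and \<open>h\<close> is the same thing
  as a filling of the diagram. Permuting entries within a row changes the element by a sign, so that
  rows may be taken increasing. With one Garnir relation, an entry of a lower row is exchanged with
  all entries of a higher row, which suffices to make the first column increasing. So the fillings that
  are standard immaculate tableaux span \<open>L\<close>. (Standard Young tableaux would give a basis, but
  sorting the other columns takes Garnir relations for several entries at once.)

  \<^bold>\<open>Faithfulness\<close> (\<open>faithful_on_immaculate_vectors\<close>). Averaging \<open>young \<alpha>\<close> over conjugation gives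
  a central element \<open>class_average \<alpha>\<close>. For different partitions these are orthogonal, because
  \<open>S * \<delta> g * A' \<noteq> 0\<close> forces a dominance relation between the shapes; and none of them squares to zero.
  Hence they are linearly independent. As a permutation is determined up to conjugacy by its cycle
  type, the centre has dimension at most the number of partitions, so they span the centre; in
  particular 1 is a combination of them. An element that annihilates all the
  ideals \<open>L\<close> annihilates every \<open>class_average \<alpha>\<close>, hence 1, hence is 0.
\<close>

section \<open>The group algebra of permutations of the natural numbers\<close>

text \<open>The group is written additively, because the convolution product on
  finitely supported functions \<open>'a \<Rightarrow>\<^sub>0 'b\<close> makes them a ring when \<open>'a\<close> is an additive monoid, which
  may be noncommutative. The symmetric group on \<open>X\<close> then is the subset \<open>perms X\<close>, and its group algebra
  is \<open>supported X\<close> below.\<close>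

typedef nat_perm = "{f :: nat \<Rightarrow> nat. bij f}"
  morphisms act Perm
  by (rule exI[of _ id]) simp

lemma bij_act [simp]: "bij (act g)"
  using act[of g] by simp

lemma act_Perm [simp]: "bij f \<Longrightarrow> act (Perm f) = f"
  by (simp add: Perm_inverse)

lemma nat_perm_eqI: "(\<And>x. act g x = act h x) \<Longrightarrow> g = h"
  by (simp add: act_inject[symmetric] fun_eq_iff)

instantiation nat_perm :: group_add
begin

definition zero_nat_perm where "0 = Perm id"
definition plus_nat_perm where "g + h = Perm (act g \<circ> act h)"
definition uminus_nat_perm where "- g = Perm (inv' (act g))"
definition minus_nat_perm where "g - h = g + - (h :: nat_perm)"

lemma act_0 [simp]: "act 0 = id"
  by (simp add: zero_nat_perm_def)

lemma act_plus [simp]: "act (g + h) = act g \<circ> act h"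
  by (simp add: plus_nat_perm_def bij_comp)

lemma act_uminus [simp]: "act (- g) = inv' (act g)"
  by (simp add: uminus_nat_perm_def bij_imp_bij_inv)

instance
proof
  fix g h k :: nat_perm
  show "g + h + k = g + (h + k)"
    by (rule nat_perm_eqI) simp
  show "0 + g = g" "g + 0 = g"
    by (rule nat_perm_eqI, simp)+
  show "- g + g = 0"
    by (rule nat_perm_eqI) (simp add: inv_f_f[OF bij_is_inj])
  show "g + - h = g - h"
    by (simp add: minus_nat_perm_def)
qed

end

definition swap :: "nat \<Rightarrow> nat \<Rightarrow> nat_perm" where
  "swap x y = Perm (transpose x y)"

lemma act_swap [simp]: "act (swap x y) = transpose x y"
  by (simp add: swap_def)

lemma conjugate_swap: "g + swap x y = swap (act g x) (act g y) + g"
  by (rule nat_perm_eqI)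
    (auto simp: transpose_def inj_eq[OF bij_is_inj])

definition perms :: "nat set \<Rightarrow> nat_perm set" where
  "perms X = {g. act g permutes X}"

lemma perms_closed [simp, intro]:
  "0 \<in> perms X"
  "g \<in> perms X \<Longrightarrow> h \<in> perms X \<Longrightarrow> g + h \<in> perms X"
  "g \<in> perms X \<Longrightarrow> - g \<in> perms X"
  by (auto simp: perms_def permutes_id permutes_compose permutes_inv)

lemma swap_in_perms: "x \<in> X \<Longrightarrow> y \<in> X \<Longrightarrow> swap x y \<in> perms X"
  by (simp add: perms_def permutes_swap_id)

lemma perms_mono: "A \<subseteq> X \<Longrightarrow> perms A \<subseteq> perms X"
  by (auto simp: perms_def intro: permutes_subset)

lemma perms_act_mem: "g \<in> perms X \<Longrightarrow> act g x \<in> X \<longleftrightarrow> x \<in> X"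
  by (simp add: perms_def permutes_in_image)

lemma Perm_in_perms: "f permutes X \<Longrightarrow> Perm f \<in> perms X"
  by (simp add: perms_def permutes_bij)

lemma bij_betw_act_perms: "bij_betw act (perms X) {f. f permutes X}"
  by (rule bij_betw_byWitness[where f' = Perm])
    (auto simp: perms_def act_inverse permutes_bij)

lemma finite_perms [simp]: "finite X \<Longrightarrow> finite (perms X)"
  using bij_betw_finite[OF bij_betw_act_perms[of X]] finite_permutations by auto

definition sg :: "nat_perm \<Rightarrow> complex" where
  "sg g = of_int (sign (act g))"

lemma sg_0 [simp]: "sg 0 = 1"
  by (simp add: sg_def)

lemma sg_swap: "x \<noteq> y \<Longrightarrow> sg (swap x y) = -1"
  by (simp add: sg_def sign_swap_id)

lemma sg_plus:
  assumes "finite X" "g \<in> perms X" "h \<in> perms X"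
  shows "sg (g + h) = sg g * sg h"
proof -
  have "permutation (act g)" "permutation (act h)"
    using assms by (auto simp: perms_def permutation_permutes)
  then show ?thesis by (simp add: sg_def sign_compose)
qed

lemma sg_square [simp]: "sg g * sg g = 1"
  by (simp add: sg_def flip: of_int_mult)

type_synonym grpalg = "nat_perm \<Rightarrow>\<^sub>0 complex"

abbreviation delta :: "nat_perm \<Rightarrow> grpalg" ("\<delta>") where
  "\<delta> g \<equiv> Poly_Mapping.single g 1"

abbreviation coef :: "grpalg \<Rightarrow> nat_perm \<Rightarrow> complex" where
  "coef \<equiv> Poly_Mapping.lookup"

definition scale :: "complex \<Rightarrow> grpalg \<Rightarrow> grpalg" (infixr "*\<^sub>S" 75) where
  "c *\<^sub>S x = Poly_Mapping.single 0 c * x"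

lemma delta_mult: "\<delta> g * \<delta> h = \<delta> (g + h)"
  by (simp add: mult_single)

lemma delta_mult_assoc: "\<delta> g * (\<delta> h * x) = \<delta> (g + h) * x"
  by (simp add: mult.assoc[symmetric] delta_mult)

lemma scale_delta: "c *\<^sub>S \<delta> g = Poly_Mapping.single g c"
  by (simp add: scale_def mult_single)

lemma expand_delta: "x = (\<Sum>g\<in>Poly_Mapping.keys x. coef x g *\<^sub>S \<delta> g)"
proof (rule poly_mapping_eqI)
  fix k
  have "coef (\<Sum>g\<in>Poly_Mapping.keys x. coef x g *\<^sub>S \<delta> g) k
      = (\<Sum>g\<in>Poly_Mapping.keys x. if g = k then coef x k else 0)"
    by (auto simp: lookup_sum scale_delta lookup_single when_def intro!: sum.cong)
  also have "\<dots> = coef x k"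
    by (simp add: sum.delta in_keys_iff)
  finally show "coef x k = coef (\<Sum>g\<in>Poly_Mapping.keys x. coef x g *\<^sub>S \<delta> g) k" ..
qed

lemma expand_delta_superset:
  assumes "finite H" "Poly_Mapping.keys x \<subseteq> H"
  shows "x = (\<Sum>g\<in>H. coef x g *\<^sub>S \<delta> g)"
  by (subst expand_delta, rule sum.mono_neutral_left)
    (use assms in \<open>auto simp: in_keys_iff scale_def\<close>)

lemma coef_scale [simp]: "coef (c *\<^sub>S x) g = c * coef x g"
  unfolding scale_def mult_map_scale_conv_mult[symmetric]
  by (simp add: Poly_Mapping.map.rep_eq when_def)

interpretation GA: vector_space scale
proof
  fix a b :: complex and x y :: grpalg
  show "a *\<^sub>S (x + y) = a *\<^sub>S x + a *\<^sub>S y" "(a + b) *\<^sub>S x = a *\<^sub>S x + b *\<^sub>S x"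
    "a *\<^sub>S (b *\<^sub>S x) = (a * b) *\<^sub>S x" "1 *\<^sub>S x = x"
    by (rule poly_mapping_eqI, simp add: lookup_add algebra_simps)+
qed

lemma scale_mult_left: "(c *\<^sub>S x) * y = c *\<^sub>S (x * y)"
  by (simp add: scale_def mult.assoc)

lemma delta_mult_scale: "\<delta> g * (c *\<^sub>S y) = c *\<^sub>S (\<delta> g * y)"
  by (simp add: scale_def mult.assoc[symmetric] mult_single)

lemma mult_scale_right: "x * (c *\<^sub>S y) = c *\<^sub>S (x * y)"
proof -
  have "x * (c *\<^sub>S y) = (\<Sum>g\<in>Poly_Mapping.keys x. coef x g *\<^sub>S (\<delta> g * (c *\<^sub>S y)))"
    by (subst expand_delta) (simp add: sum_distrib_right scale_mult_left)
  also have "\<dots> = c *\<^sub>S (\<Sum>g\<in>Poly_Mapping.keys x. coef x g *\<^sub>S (\<delta> g * y))"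
    by (simp add: delta_mult_scale GA.scale_sum_right mult.commute)
  also have "(\<Sum>g\<in>Poly_Mapping.keys x. coef x g *\<^sub>S (\<delta> g * y)) = x * y"
    by (subst (3) expand_delta) (simp add: sum_distrib_right scale_mult_left)
  finally show ?thesis .
qed

definition supported :: "nat set \<Rightarrow> grpalg set" where
  "supported X = {x. Poly_Mapping.keys x \<subseteq> perms X}"

lemma supported_delta: "g \<in> perms X \<Longrightarrow> \<delta> g \<in> supported X"
  by (simp add: supported_def)

section \<open>Symmetrizers and antisymmetrizers of subgroups\<close>

definition subgrp :: "nat set \<Rightarrow> nat_perm set \<Rightarrow> bool" where
  "subgrp X H \<longleftrightarrow> finite X \<and> H \<subseteq> perms X \<and> 0 \<in> H \<and>
     (\<forall>g\<in>H. \<forall>h\<in>H. g + h \<in> H) \<and> (\<forall>g\<in>H. - g \<in> H)"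

lemma subgrp_perms: "finite X \<Longrightarrow> A \<subseteq> X \<Longrightarrow> subgrp X (perms A)"
  using perms_mono by (auto simp: subgrp_def)

lemma subgrp_sum_left:
  assumes "subgrp X H" "t \<in> H"
  shows "(\<Sum>h\<in>H. f (t + h)) = (\<Sum>h\<in>H. f h)"
  using assms
  by (intro sum.reindex_bij_witness[of _ "\<lambda>h. - t + h" "\<lambda>h. t + h"])
    (auto simp: subgrp_def add.assoc[symmetric])

lemma subgrp_sum_right:
  assumes "subgrp X H" "t \<in> H"
  shows "(\<Sum>h\<in>H. f (h + t)) = (\<Sum>h\<in>H. f h)"
  using assms
  by (intro sum.reindex_bij_witness[of _ "\<lambda>h. h + (- t)" "\<lambda>h. h + t"])
    (auto simp: subgrp_def add.assoc simp del: add_uminus_conv_diff)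

definition sym_sum :: "nat_perm set \<Rightarrow> grpalg" where
  "sym_sum H = (\<Sum>h\<in>H. \<delta> h)"

definition alt_sum :: "nat_perm set \<Rightarrow> grpalg" where
  "alt_sum H = (\<Sum>h\<in>H. sg h *\<^sub>S \<delta> h)"

lemma delta_sym_sum: "subgrp X H \<Longrightarrow> t \<in> H \<Longrightarrow> \<delta> t * sym_sum H = sym_sum H"
  using subgrp_sum_left[of X H t \<delta>]
  by (simp add: sym_sum_def sum_distrib_left delta_mult)

lemma sym_sum_delta: "subgrp X H \<Longrightarrow> t \<in> H \<Longrightarrow> sym_sum H * \<delta> t = sym_sum H"
  using subgrp_sum_right[of X H t \<delta>]
  by (simp add: sym_sum_def sum_distrib_right delta_mult)

lemma delta_alt_sum:
  assumes "subgrp X H" "t \<in> H"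
  shows "\<delta> t * alt_sum H = sg t *\<^sub>S alt_sum H"
proof -
  have "sg t *\<^sub>S (\<delta> t * alt_sum H) = (\<Sum>h\<in>H. sg (t + h) *\<^sub>S \<delta> (t + h))"
    unfolding alt_sum_def sum_distrib_left GA.scale_sum_right
    using assms by (intro sum.cong refl)
      (auto simp: delta_mult_scale delta_mult subgrp_def subset_iff intro!: arg_cong2[of _ _ _ _ scale] sg_plus[symmetric])
  also have "\<dots> = alt_sum H"
    unfolding alt_sum_def by (rule subgrp_sum_left[OF assms])
  finally have "sg t *\<^sub>S (sg t *\<^sub>S (\<delta> t * alt_sum H)) = sg t *\<^sub>S alt_sum H"
    by simp
  then show ?thesis by simp
qed

lemma alt_sum_delta:
  assumes "subgrp X H" "t \<in> H"
  shows "alt_sum H * \<delta> t = sg t *\<^sub>S alt_sum H"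
proof -
  have "sg t *\<^sub>S (alt_sum H * \<delta> t) = (\<Sum>h\<in>H. sg (h + t) *\<^sub>S \<delta> (h + t))"
    unfolding alt_sum_def sum_distrib_right GA.scale_sum_right
    using assms by (intro sum.cong refl)
      (auto simp: scale_mult_left delta_mult subgrp_def subset_iff mult.commute intro!: arg_cong2[of _ _ _ _ scale] sg_plus[symmetric])
  also have "\<dots> = alt_sum H"
    unfolding alt_sum_def by (rule subgrp_sum_right[OF assms])
  finally have "sg t *\<^sub>S (sg t *\<^sub>S (alt_sum H * \<delta> t)) = sg t *\<^sub>S alt_sum H"
    by simp
  then show ?thesis by simp
qed

definition stab :: "nat set \<Rightarrow> (nat \<Rightarrow> nat) \<Rightarrow> nat_perm set" where
  "stab X f = {g \<in> perms X. \<forall>x\<in>X. f (act g x) = f x}"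

lemma subgrp_stab: "finite X \<Longrightarrow> subgrp X (stab X f)"
proof -
  have "f (inv' (act g) x) = f x" if "g \<in> perms X" "\<forall>x\<in>X. f (act g x) = f x" "x \<in> X" for g x
    using that perms_act_mem[of "-g" X x]
    by (metis act_uminus bij_act bij_inv_eq_iff perms_closed(3))
  then show "finite X \<Longrightarrow> subgrp X (stab X f)"
    by (auto simp: subgrp_def stab_def perms_act_mem)
qed

lemma swap_in_stab: "x \<in> X \<Longrightarrow> y \<in> X \<Longrightarrow> f x = f y \<Longrightarrow> swap x y \<in> stab X f"
  by (auto simp: stab_def swap_in_perms transpose_def)

lemma eq_uminus_self_imp_zero:
  fixes x :: grpalg
  assumes "x = - x"
  shows "x = 0"
proof (rule poly_mapping_eqI)
  fix k have "coef x k = - coef x k" by (subst assms) (rule lookup_uminus)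
  then show "coef x k = coef 0 k" by simp
qed

section \<open>The Garnir relation\<close>

lemma sum_perms_insert:
  fixes f :: "nat_perm \<Rightarrow> 'a::comm_monoid_add"
  assumes "finite R" "b \<notin> R"
  shows "(\<Sum>g\<in>perms (insert b R). f g) =
    (\<Sum>q\<in>perms R. f q) + (\<Sum>x\<in>R. \<Sum>q\<in>perms R. f (swap x b + q))"
proof -
  have *: "(\<Sum>g\<in>perms Y. k (act g)) = (\<Sum>p | p permutes Y. k p)" for Y and k :: "(nat \<Rightarrow> nat) \<Rightarrow> 'a"
    by (rule sum.reindex_bij_betw[OF bij_betw_act_perms])
  have "(\<Sum>g\<in>perms (insert b R). f g) = (\<Sum>g\<in>perms (insert b R). f (Perm (act g)))"
    by (simp add: act_inverse)
  also have "\<dots> = (\<Sum>x\<in>insert b R. \<Sum>q\<in>perms R. f (Perm (transpose b x \<circ> act q)))"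
    unfolding *[of "\<lambda>p. f (Perm p)"] *[of "\<lambda>p. f (Perm (transpose b _ \<circ> p))"]
    by (rule sum_over_permutations_insert[OF assms])
  also have "\<dots> = (\<Sum>x\<in>insert b R. \<Sum>q\<in>perms R. f (swap x b + q))"
    by (simp add: plus_nat_perm_def transpose_commute[of b])
  also have "\<dots> = (\<Sum>q\<in>perms R. f (swap b b + q)) + (\<Sum>x\<in>R. \<Sum>q\<in>perms R. f (swap x b + q))"
    using assms by simp
  also have "swap b b = 0"
    by (rule nat_perm_eqI) simp
  finally show ?thesis by simp
qed

text \<open>The transpositions \<open>swap x b\<close> with \<open>x \<in> R\<close>, together with the identity,
  represent the cosets of the permutations of \<open>R\<close> in those of \<open>insert b R\<close>.\<close>

lemma alt_sum_perms_insert: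
  assumes "finite R" "b \<notin> R"
  shows "alt_sum (perms (insert b R)) = (1 - (\<Sum>x\<in>R. \<delta> (swap x b))) * alt_sum (perms R)"
proof -
  have sgn: "sg (swap x b + q) = - sg q" if "x \<in> R" "q \<in> perms R" for x q
  proof -
    have "q \<in> perms (insert b R)" using perms_mono[of R "insert b R"] that by auto
    moreover have "swap x b \<in> perms (insert b R)" using that by (intro swap_in_perms) auto
    moreover have "x \<noteq> b" using that assms by auto
    ultimately show ?thesis using assms by (simp add: sg_plus[of "insert b R"] sg_swap)
  qed
  have "(\<Sum>x\<in>R. \<Sum>q\<in>perms R. sg (swap x b + q) *\<^sub>S \<delta> (swap x b + q))
     = - (\<Sum>x\<in>R. \<delta> (swap x b)) * alt_sum (perms R)"
    by (simp add: sgn alt_sum_def sum_distrib_left sum_distrib_right mult_scale_right delta_mult sum_negf)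
      (unfold GA.scale_sum_right, rule sum.swap)
  then show ?thesis
    by (simp add: alt_sum_def sum_perms_insert[OF assms] algebra_simps)
qed

text \<open>The antisymmetrizer \<open>G\<close> of \<open>insert b R\<close> kills the Young element: after any row permutation
  the \<open>card R + 1\<close> labels of \<open>insert b R\<close> occupy at most \<open>card R\<close> columns, so that two of them share a
  column, and their transposition is absorbed by the column symmetrizer but reverses the sign of \<open>G\<close>.
  Factoring \<open>G\<close> through the cosets of the permutations of \<open>R\<close>, whose antisymmetrizer is absorbed
  by the row antisymmetrizer, leaves the relation.\<close>

lemma garnir_relation:
  fixes row col :: "nat \<Rightarrow> nat" and X :: "nat set"
  defines "young \<equiv> alt_sum (stab X row) * sym_sum (stab X col)"
  assumes X: "finite X" and b: "b \<in> X" "row b \<noteq> i"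
    and R: "R = {x \<in> X. row x = i}"
    and col: "\<And>x. x \<in> X \<Longrightarrow> row x \<in> {i, row b} \<Longrightarrow> col x < card R"
  shows "young = (\<Sum>x\<in>R. \<delta> (swap x b) * young)"
proof -
  define A where "A = alt_sum (stab X row)"
  define S where "S = sym_sum (stab X col)"
  define B where "B = insert b R"
  define G where "G = alt_sum (perms B)"
  have fin: "finite R" "b \<notin> R" and BX: "B \<subseteq> X" "R \<subseteq> X"
    using X R b by (auto simp: B_def)
  have zero: "G * (\<delta> h * S) = 0" if h: "h \<in> stab X row" for h
  proof -
    let ?f = "\<lambda>x. col (act (- h) x)"
    have h': "- h \<in> stab X row"
      using subgrp_stab[OF X, of row] h by (auto simp: subgrp_def)
    have "?f x < card R" if "x \<in> B" for x
    proof (rule col)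
      have "x \<in> X" "row x \<in> {i, row b}"
        using that BX R by (auto simp: B_def)
      then show "act (- h) x \<in> X" "row (act (- h) x) \<in> {i, row b}"
        using h' by (auto simp: stab_def perms_act_mem simp del: act_uminus)
    qed
    then have "?f ` B \<subseteq> {..<card R}"
      by blast
    then have "\<not> inj_on ?f B"
      using card_inj_on_le[of ?f B "{..<card R}"] fin by (auto simp: B_def)
    then obtain x y where xy: "x \<in> B" "y \<in> B" "x \<noteq> y" "?f x = ?f y"
      by (auto simp: inj_on_def)
    define x' y' where "x' = act (- h) x" and "y' = act (- h) y"
    have act: "act h x' = x" "act h y' = y"
      by (simp_all add: x'_def y'_def surj_f_inv_f[OF bij_is_surj])
    have "x' \<in> X" "y' \<in> X" "col x' = col y'"
      using xy BX h' by (auto simp: x'_def y'_def stab_def perms_act_mem simp del: act_uminus)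
    then have "swap x' y' \<in> stab X col"
      by (intro swap_in_stab)
    then have "\<delta> h * S = \<delta> h * (\<delta> (swap x' y') * S)"
      by (simp add: S_def delta_sym_sum[OF subgrp_stab[OF X]])
    also have "\<dots> = \<delta> (swap x y) * (\<delta> h * S)"
      by (simp add: delta_mult_assoc conjugate_swap act)
    finally have "G * (\<delta> h * S) = (G * \<delta> (swap x y)) * (\<delta> h * S)"
      by (simp add: mult.assoc)
    also have "G * \<delta> (swap x y) = - G"
      using alt_sum_delta[OF subgrp_perms[OF X BX(1)] swap_in_perms[OF xy(1,2)]]
      by (simp add: G_def sg_swap[OF xy(3)])
    finally show ?thesis
      by (intro eq_uminus_self_imp_zero) simp
  qed
  have "G * (A * S) = 0"
    by (simp add: A_def alt_sum_def sum_distrib_right sum_distrib_left scale_mult_left mult_scale_right zero)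
  moreover have "alt_sum (perms R) * A = of_nat (card (perms R)) *\<^sub>S A"
  proof -
    have "q \<in> stab X row" if "q \<in> perms R" for q
    proof -
      have "row (act q x) = row x" if "x \<in> X" for x
      proof (cases "x \<in> R")
        case True
        then show ?thesis using perms_act_mem[OF \<open>q \<in> perms R\<close>, of x] by (simp add: R)
      next
        case False
        then show ?thesis using \<open>q \<in> perms R\<close> by (simp add: perms_def permutes_not_in)
      qed
      then show ?thesis using that perms_mono[OF BX(2)] by (auto simp: stab_def)
    qed
    then have "alt_sum (perms R) * A = (\<Sum>q\<in>perms R. A)"
      unfolding alt_sum_def sum_distrib_right scale_mult_left
      by (intro sum.cong refl) (simp add: A_def delta_alt_sum[OF subgrp_stab[OF X]])
    then show ?thesis
      by (simp only: GA.sum_constant_scale)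
  qed
  then have "G * (A * S) = of_nat (card (perms R)) *\<^sub>S ((1 - (\<Sum>x\<in>R. \<delta> (swap x b))) * (A * S))"
    unfolding G_def B_def alt_sum_perms_insert[OF fin]
    by (simp add: mult.assoc[symmetric] scale_mult_left)
      (simp add: mult.assoc scale_mult_left mult_scale_right)
  moreover have "card (perms R) \<noteq> 0"
    using fin(1) perms_closed(1)[of R] card_0_eq[OF finite_perms] by blast
  ultimately have "(1 - (\<Sum>x\<in>R. \<delta> (swap x b))) * (A * S) = 0"
    by simp
  then show ?thesis
    by (simp add: young_def A_def S_def algebra_simps sum_distrib_right)
qed

section \<open>Labelled diagrams and Young elements\<close>

definition partitions :: "nat \<Rightarrow> nat list set" where
  "partitions n = {\<alpha> \<in> compositions n. sorted_wrt (\<ge>) \<alpha>}"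

lemma finite_partitions: "finite (partitions n)"
  using finite_compositions by (auto simp: partitions_def)

lemma card_diagram: "card (diagram \<alpha>) = sum_list \<alpha>"
proof -
  have "diagram \<alpha> = (SIGMA i:{..<length \<alpha>}. {..<\<alpha> ! i})"
    by (auto simp: diagram_def)
  then show ?thesis
    by (simp add: sum_list_sum_nth lessThan_atLeast0)
qed

text \<open>A fixed labelling of the diagram. Another choice would replace \<open>young \<alpha>\<close> by a conjugate,
  and its left ideal by an isomorphic module.\<close>

definition cell :: "nat list \<Rightarrow> nat \<Rightarrow> nat \<times> nat" where
  "cell \<alpha> = (SOME f. bij_betw f {1..sum_list \<alpha>} (diagram \<alpha>))"

definition cell_row :: "nat list \<Rightarrow> nat \<Rightarrow> nat" where
  "cell_row \<alpha> x = fst (cell \<alpha> x)"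

definition cell_col :: "nat list \<Rightarrow> nat \<Rightarrow> nat" where
  "cell_col \<alpha> x = snd (cell \<alpha> x)"

lemma bij_betw_cell_sum: "bij_betw (cell \<alpha>) {1..sum_list \<alpha>} (diagram \<alpha>)"
proof -
  have "\<exists>f. bij_betw f {1..sum_list \<alpha>} (diagram \<alpha>)"
    by (rule finite_same_card_bij) (simp_all add: finite_diagram card_diagram)
  then show ?thesis
    unfolding cell_def by (rule someI_ex)
qed

lemma bij_betw_cell: "\<alpha> \<in> compositions n \<Longrightarrow> bij_betw (cell \<alpha>) {1..n} (diagram \<alpha>)"
  using bij_betw_cell_sum[of \<alpha>] by (simp add: compositions_def)

lemma cell_eq: "cell \<alpha> x = (cell_row \<alpha> x, cell_col \<alpha> x)"
  by (simp add: cell_row_def cell_col_def)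

lemma row_col_in_diagram:
  "\<alpha> \<in> compositions n \<Longrightarrow> x \<in> {1..n} \<Longrightarrow> (cell_row \<alpha> x, cell_col \<alpha> x) \<in> diagram \<alpha>"
  using bij_betwE[OF bij_betw_cell] by (simp add: cell_eq)

lemma row_col_inj:
  "\<alpha> \<in> compositions n \<Longrightarrow> x \<in> {1..n} \<Longrightarrow> y \<in> {1..n} \<Longrightarrow>
    cell_row \<alpha> x = cell_row \<alpha> y \<Longrightarrow> cell_col \<alpha> x = cell_col \<alpha> y \<Longrightarrow> x = y"
  using inj_onD[OF bij_betw_imp_inj_on[OF bij_betw_cell[of \<alpha> n]], of x y] by (simp add: cell_eq)

lemma row_col_surj:
  assumes "\<alpha> \<in> compositions n" "(i, j) \<in> diagram \<alpha>"
  obtains x where "x \<in> {1..n}" "cell_row \<alpha> x = i" "cell_col \<alpha> x = j"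
proof -
  have "(i, j) \<in> cell \<alpha> ` {1..n}"
    using bij_betw_imp_surj_on[OF bij_betw_cell[OF assms(1)]] assms(2) by simp
  then show ?thesis
    using that by (auto simp: cell_eq)
qed

lemma card_row:
  assumes "\<alpha> \<in> compositions n" "i < length \<alpha>"
  shows "card {x \<in> {1..n}. cell_row \<alpha> x = i} = \<alpha> ! i"
proof -
  have "bij_betw (cell_col \<alpha>) {x \<in> {1..n}. cell_row \<alpha> x = i} {..<\<alpha> ! i}"
    unfolding bij_betw_def
  proof
    show "inj_on (cell_col \<alpha>) {x \<in> {1..n}. cell_row \<alpha> x = i}"
      using row_col_inj[OF assms(1)] by (auto simp: inj_on_def)
    show "cell_col \<alpha> ` {x \<in> {1..n}. cell_row \<alpha> x = i} = {..<\<alpha> ! i}"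
    proof (intro equalityI subsetI)
      fix j assume "j \<in> {..<\<alpha> ! i}"
      then have "(i, j) \<in> diagram \<alpha>" using assms by (simp add: diagram_def)
      then obtain x where "x \<in> {1..n}" "cell_row \<alpha> x = i" "cell_col \<alpha> x = j"
        by (rule row_col_surj[OF assms(1)])
      then show "j \<in> cell_col \<alpha> ` {x \<in> {1..n}. cell_row \<alpha> x = i}" by auto
    qed (use row_col_in_diagram[OF assms(1)] in \<open>auto simp: diagram_def\<close>)
  qed
  then show ?thesis
    by (simp add: bij_betw_same_card)
qed

lemma partition_antimono:
  assumes "\<alpha> \<in> partitions n" "i \<le> i'" "i' < length \<alpha>"
  shows "\<alpha> ! i' \<le> \<alpha> ! i"
  using assms by (cases "i = i'") (auto simp: partitions_def sorted_wrt_iff_nth_less)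

lemma partition_composition: "\<alpha> \<in> partitions n \<Longrightarrow> \<alpha> \<in> compositions n"
  by (simp add: partitions_def)

definition young :: "nat list \<Rightarrow> grpalg" where
  "young \<alpha> = alt_sum (stab {1..sum_list \<alpha>} (cell_row \<alpha>)) * sym_sum (stab {1..sum_list \<alpha>} (cell_col \<alpha>))"

lemma young_eq:
  "\<alpha> \<in> compositions n \<Longrightarrow>
    young \<alpha> = alt_sum (stab {1..n} (cell_row \<alpha>)) * sym_sum (stab {1..n} (cell_col \<alpha>))"
  by (simp add: young_def compositions_def)

section \<open>Straightening to standard immaculate tableaux\<close>

definition tableau :: "nat list \<Rightarrow> nat_perm \<Rightarrow> nat \<times> nat \<Rightarrow> nat" where
  "tableau \<alpha> h = (\<lambda>u\<in>diagram \<alpha>. act h (inv_into {1..sum_list \<alpha>} (cell \<alpha>) u))"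

definition immaculate_vectors :: "nat list \<Rightarrow> grpalg set" where
  "immaculate_vectors \<alpha> =
    (\<lambda>h. \<delta> h * young \<alpha>) ` {h \<in> perms {1..sum_list \<alpha>}. tableau \<alpha> h \<in> standard_immaculate_tableaux \<alpha>}"

lemma tableau_cell:
  "\<alpha> \<in> compositions n \<Longrightarrow> x \<in> {1..n} \<Longrightarrow> tableau \<alpha> h (cell_row \<alpha> x, cell_col \<alpha> x) = act h x"
  using bij_betw_inv_into_left[OF bij_betw_cell, of \<alpha> n x] row_col_in_diagram[of \<alpha> n x]
  by (simp add: tableau_def cell_eq compositions_def)

lemma card_immaculate_vectors: "card (immaculate_vectors \<alpha>) \<le> immaculate_number \<alpha>"
  and finite_immaculate_vectors: "finite (immaculate_vectors \<alpha>)"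
proof -
  let ?X = "{1..sum_list \<alpha>}"
  let ?H = "{h \<in> perms ?X. tableau \<alpha> h \<in> standard_immaculate_tableaux \<alpha>}"
  have "inj_on (tableau \<alpha>) (perms ?X)"
  proof (rule inj_onI, rule nat_perm_eqI)
    fix g h x assume gh: "g \<in> perms ?X" "h \<in> perms ?X" "tableau \<alpha> g = tableau \<alpha> h"
    show "act g x = act h x"
    proof (cases "x \<in> ?X")
      case True
      then have "cell \<alpha> x \<in> diagram \<alpha>" "inv_into ?X (cell \<alpha>) (cell \<alpha> x) = x"
        using bij_betw_cell_sum[of \<alpha>] by (auto simp: bij_betw_inv_into_left bij_betwE)
      then show ?thesis
        using fun_cong[OF gh(3), of "cell \<alpha> x"] by (simp add: tableau_def)
    next
      case False
      then show ?thesis using gh by (simp add: perms_def permutes_not_in)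
    qed
  qed
  then have "inj_on (tableau \<alpha>) ?H"
    by (rule inj_on_subset) auto
  then have "card ?H \<le> immaculate_number \<alpha>"
    unfolding immaculate_number_def
    by (rule card_inj_on_le) (use finite_standard_immaculate_tableaux in auto)
  moreover have fin: "finite ?H"
    by simp
  ultimately show "card (immaculate_vectors \<alpha>) \<le> immaculate_number \<alpha>" "finite (immaculate_vectors \<alpha>)"
    using card_image_le[OF fin, of "\<lambda>h. \<delta> h * young \<alpha>"] by (auto simp: immaculate_vectors_def)
qed

lemma tableau_standardI:
  assumes \<alpha>: "\<alpha> \<in> compositions n" and h: "h \<in> perms {1..n}"
    and rows: "\<And>x y. x \<in> {1..n} \<Longrightarrow> y \<in> {1..n} \<Longrightarrow> cell_row \<alpha> x = cell_row \<alpha> y \<Longrightarrow> cell_col \<alpha> x < cell_col \<alpha> y \<Longrightarrow>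
        act h x < act h y"
    and first_col: "\<And>x y. x \<in> {1..n} \<Longrightarrow> y \<in> {1..n} \<Longrightarrow> cell_row \<alpha> x < cell_row \<alpha> y \<Longrightarrow> cell_col \<alpha> x = 0 \<Longrightarrow>
        cell_col \<alpha> y = 0 \<Longrightarrow> act h x < act h y"
  shows "tableau \<alpha> h \<in> standard_immaculate_tableaux \<alpha>"
proof -
  have n: "sum_list \<alpha> = n" using \<alpha> by (simp add: compositions_def)
  have "bij_betw (act h \<circ> inv_into {1..n} (cell \<alpha>)) (diagram \<alpha>) {1..n}"
    by (rule bij_betw_trans[OF bij_betw_inv_into[OF bij_betw_cell[OF \<alpha>]]])
      (use h in \<open>simp add: perms_def permutes_imp_bij\<close>)
  then have "bij_betw (tableau \<alpha> h) (diagram \<alpha>) {1..n}"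
    by (rule bij_betw_cong[THEN iffD1, rotated]) (simp add: tableau_def n)
  moreover have "tableau \<alpha> h \<in> extensional (diagram \<alpha>)"
    by (simp add: tableau_def)
  moreover have "tableau \<alpha> h (i, j) < tableau \<alpha> h (i, j')"
    if "(i, j) \<in> diagram \<alpha>" "(i, j') \<in> diagram \<alpha>" "j < j'" for i j j'
    using that by (metis \<alpha> row_col_surj rows tableau_cell)
  moreover have "tableau \<alpha> h (i, 0) < tableau \<alpha> h (i', 0)"
    if "(i, 0) \<in> diagram \<alpha>" "(i', 0) \<in> diagram \<alpha>" "i < i'" for i i'
    using that by (metis \<alpha> row_col_surj first_col tableau_cell)
  ultimately show ?thesis
    by (simp add: standard_immaculate_tableaux_def n)
qed

text \<open>The rearrangement inequality for two terms. It is the reason why straightening terminates.\<close>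

lemma weight_swap_less:
  fixes w f :: "nat \<Rightarrow> nat"
  assumes "finite X" "x \<in> X" "y \<in> X" "w x < w y" "f y < f x"
  shows "(\<Sum>z\<in>X. w z * f z) < (\<Sum>z\<in>X. w z * f (transpose x y z))"
proof -
  have xy: "x \<noteq> y" using assms by auto
  have split: "sum k X = sum k (X - {x, y}) + (k x + k y)" for k :: "nat \<Rightarrow> nat"
    using sum.subset_diff[of "{x, y}" X k] assms xy by auto
  obtain d e where "w y = w x + Suc d" "f x = f y + Suc e"
    using assms less_iff_Suc_add by auto
  then have "w x * f x + w y * f y < w x * f y + w y * f x"
    by (simp add: algebra_simps)
  moreover have "(\<Sum>z\<in>X - {x, y}. w z * f (transpose x y z)) = (\<Sum>z\<in>X - {x, y}. w z * f z)"
    by (intro sum.cong) (auto simp: transpose_def)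
  ultimately show ?thesis
    by (simp add: split[of "\<lambda>z. w z * f z"] split[of "\<lambda>z. w z * f (transpose x y z)"])
qed

text \<open>Each violation of the immaculate conditions by the filling \<open>h\<close> is a pair of positions
  \<open>x\<close>, \<open>y\<close> with \<open>w x < w y\<close> in the reading order \<open>w\<close> (row by row) but \<open>act h y < act h x\<close>. Exchanging the
  two entries increases the weight \<open>W\<close>, which is bounded. For a violation in the first column the
  Garnir relation expresses the element by exchanges of \<open>y\<close> with \<^emph>\<open>all\<close> positions of the row of \<open>x\<close>; as
  that row is increasing, all of these increase \<open>W\<close>.\<close>

lemma straightening:
  assumes \<alpha>: "\<alpha> \<in> partitions n" and "h \<in> perms {1..n}"
  shows "\<delta> h * young \<alpha> \<in> GA.span (immaculate_vectors \<alpha>)"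
proof -
  let ?X = "{1..n}"
  define w where "w x = n * cell_row \<alpha> x + cell_col \<alpha> x" for x
  define W where "W h = (\<Sum>x\<in>?X. w x * act h x)" for h
  define M where "M = (\<Sum>x\<in>?X. w x * n)"
  have comp: "\<alpha> \<in> compositions n" and n: "sum_list \<alpha> = n"
    using \<alpha> by (auto simp: partitions_def compositions_def)
  have col_n: "cell_col \<alpha> x < n" if "x \<in> ?X" for x
    using row_col_in_diagram[OF comp that] elem_le_sum_list[of "cell_row \<alpha> x" \<alpha>] n
    by (auto simp: diagram_def)
  have W_le: "W h \<le> M" if "h \<in> perms ?X" for h
    unfolding W_def M_def using perms_act_mem[OF that] by (intro sum_mono mult_left_mono) auto
  have W_swap: "W h < W (h + swap x y)"
    if "x \<in> ?X" "y \<in> ?X" "w x < w y" "act h y < act h x" for h x y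
    using weight_swap_less[of ?X x y w "act h"] that by (simp add: W_def)
  show ?thesis
    using assms(2)
  proof (induction "M - W h" arbitrary: h rule: less_induct)
    case less
    have IH: "\<delta> (h + swap x y) * young \<alpha> \<in> GA.span (immaculate_vectors \<alpha>)"
      if "x \<in> ?X" "y \<in> ?X" "w x < w y" "act h y < act h x" for x y
    proof -
      have "h + swap x y \<in> perms ?X"
        using less.prems that by (intro perms_closed swap_in_perms)
      with W_swap[OF that] W_le[OF this] show ?thesis
        by (intro less.hyps) auto
    qed
    have inj: "act h x \<noteq> act h y" if "x \<noteq> y" for x y
      using that by (simp add: inj_eq[OF bij_is_inj])
    \<comment> \<open>A first-column violation is used only once all rows are increasing.\<close>
    consider (row) x y where "x \<in> ?X" "y \<in> ?X" "cell_row \<alpha> x = cell_row \<alpha> y" "cell_col \<alpha> x < cell_col \<alpha> y" "act h y < act h x"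
      | (column) x y where "x \<in> ?X" "y \<in> ?X" "cell_row \<alpha> x < cell_row \<alpha> y" "cell_col \<alpha> x = 0" "cell_col \<alpha> y = 0" "act h y < act h x"
          "\<And>z. z \<in> ?X \<Longrightarrow> cell_row \<alpha> z = cell_row \<alpha> x \<Longrightarrow> act h y < act h z"
      | (standard) "tableau \<alpha> h \<in> standard_immaculate_tableaux \<alpha>"
    proof (cases "\<exists>x\<in>?X. \<exists>y\<in>?X. cell_row \<alpha> x = cell_row \<alpha> y \<and> cell_col \<alpha> x < cell_col \<alpha> y \<and> act h y < act h x")
      case True
      then show ?thesis using row by blast
    next
      case no_row: False
      have rows: "act h x < act h y"
        if "x \<in> ?X" "y \<in> ?X" "cell_row \<alpha> x = cell_row \<alpha> y" "cell_col \<alpha> x < cell_col \<alpha> y" for x y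
        using no_row that inj[of x y] by (metis less_irrefl linorder_neqE_nat)
      show ?thesis
      proof (cases "\<exists>x\<in>?X. \<exists>y\<in>?X. cell_row \<alpha> x < cell_row \<alpha> y \<and> cell_col \<alpha> x = 0 \<and> cell_col \<alpha> y = 0 \<and> act h y < act h x")
        case True
        then obtain x y where xy: "x \<in> ?X" "y \<in> ?X" "cell_row \<alpha> x < cell_row \<alpha> y" "cell_col \<alpha> x = 0" "cell_col \<alpha> y = 0"
          "act h y < act h x" by blast
        have "act h y < act h z" if "z \<in> ?X" "cell_row \<alpha> z = cell_row \<alpha> x" for z
        proof (cases "z = x")
          case False
          then have "cell_col \<alpha> z \<noteq> 0"
            using row_col_inj[OF comp that(1) xy(1)] that xy by auto
          then show ?thesis
            using rows[OF xy(1) that(1)] that xy by auto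
        qed (use xy in simp)
        then show ?thesis using column xy by blast
      next
        case False
        show ?thesis
          by (rule standard, rule tableau_standardI[OF comp less.prems rows])
            (use False inj in \<open>metis less_irrefl linorder_neqE_nat\<close>)+
      qed
    qed
    then show ?case
    proof cases
      case (row x y)
      have "\<delta> (swap x y) * young \<alpha> = - young \<alpha>"
      proof -
        have "x \<noteq> y" using row(4) by auto
        then have "\<delta> (swap x y) * alt_sum (stab ?X (cell_row \<alpha>)) = - alt_sum (stab ?X (cell_row \<alpha>))"
          using delta_alt_sum[OF subgrp_stab swap_in_stab[of x ?X y "cell_row \<alpha>"]] row(1-3)
          by (simp add: sg_swap)
        then show ?thesis
          by (metis young_eq[OF comp] mult.assoc mult_minus_left)
      qed
      then have "\<delta> h * young \<alpha> = - (\<delta> (h + swap x y) * young \<alpha>)"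
        by (metis delta_mult_assoc minus_minus mult_minus_right)
      moreover have "w x < w y"
        using row by (simp add: w_def)
      ultimately show ?thesis
        using IH[OF row(1,2) _ row(5)] by (simp add: GA.span_neg)
    next
      case (column x y)
      define R where "R = {z \<in> ?X. cell_row \<alpha> z = cell_row \<alpha> x}"
      have len: "cell_row \<alpha> x < length \<alpha>" "cell_row \<alpha> y < length \<alpha>"
        using row_col_in_diagram[OF comp] column(1,2) by (auto simp: diagram_def)
      have "cell_col \<alpha> z < card R" if "z \<in> ?X" "cell_row \<alpha> z \<in> {cell_row \<alpha> x, cell_row \<alpha> y}" for z
        using row_col_in_diagram[OF comp that(1)] that(2)
          partition_antimono[OF \<alpha> less_imp_le[OF column(3)] len(2)] card_row[OF comp len(1)]
        by (auto simp: R_def diagram_def)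
      then have "young \<alpha> = (\<Sum>z\<in>R. \<delta> (swap z y) * young \<alpha>)"
        unfolding young_eq[OF comp]
        by (intro garnir_relation[OF _ column(2), where i = "cell_row \<alpha> x"])
          (use column(3) R_def in auto)
      then have "\<delta> h * young \<alpha> = (\<Sum>z\<in>R. \<delta> (h + swap z y) * young \<alpha>)"
        by (metis (no_types, lifting) delta_mult_assoc sum.cong sum_distrib_left)
      moreover have "\<delta> (h + swap z y) * young \<alpha> \<in> GA.span (immaculate_vectors \<alpha>)" if "z \<in> R" for z
      proof (rule IH)
        have "n * cell_row \<alpha> z + cell_col \<alpha> z < n * Suc (cell_row \<alpha> x)"
          using that col_n[of z] by (auto simp: R_def)
        also have "\<dots> \<le> n * cell_row \<alpha> y"
          using column(3) by (intro mult_left_mono) auto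
        finally show "w z < w y" by (simp add: w_def)
      qed (use that column in \<open>auto simp: R_def\<close>)
      ultimately show ?thesis
        by (simp add: GA.span_sum)
    next
      case standard
      then show ?thesis
        using less.prems by (intro GA.span_base) (auto simp: immaculate_vectors_def n)
    qed
  qed
qed

section \<open>Orthogonal central elements\<close>

text \<open>The transposition of \<open>x\<close> and \<open>y\<close> changes the sign of the right factor; moved past \<open>g\<close> it is
  absorbed by the left one.\<close>

lemma sym_delta_alt_eq_0:
  fixes row col :: "nat \<Rightarrow> nat"
  assumes X: "finite X" and g: "g \<in> perms X"
    and xy: "x \<in> X" "y \<in> X" "x \<noteq> y" "row x = row y" "col (act g x) = col (act g y)"
  shows "sym_sum (stab X col) * (\<delta> g * alt_sum (stab X row)) = 0"
proof -
  let ?S = "sym_sum (stab X col)" and ?A = "alt_sum (stab X row)"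
  have "?S * (\<delta> g * ?A) = (?S * \<delta> (swap (act g x) (act g y))) * (\<delta> g * ?A)"
    using swap_in_stab[of "act g x" X "act g y" col] xy g
    by (simp add: sym_sum_delta[OF subgrp_stab[OF X]] perms_act_mem)
  also have "\<dots> = ?S * (\<delta> g * (\<delta> (swap x y) * ?A))"
    by (simp add: mult.assoc delta_mult_assoc conjugate_swap)
  also have "\<delta> (swap x y) * ?A = - ?A"
    using delta_alt_sum[OF subgrp_stab[OF X] swap_in_stab[OF xy(1,2,4)]] by (simp add: sg_swap[OF xy(3)])
  finally show ?thesis
    unfolding mult_minus_right by (rule eq_uminus_self_imp_zero)
qed

lemma card_fibres:
  assumes "finite S" "finite J" "f ` S \<subseteq> J"
  shows "card S = (\<Sum>j\<in>J. card {x \<in> S. f x = j})"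
  using sum.group[OF assms, of "\<lambda>_. 1 :: nat"] by simp

lemma partition_diagram_down:
  "\<alpha> \<in> partitions n \<Longrightarrow> (i, j) \<in> diagram \<alpha> \<Longrightarrow> i' \<le> i \<Longrightarrow> (i', j) \<in> diagram \<alpha>"
  using partition_antimono[of \<alpha> n i' i] by (auto simp: diagram_def)

text \<open>Dominance order: by hypothesis, once the labels have been moved by \<open>g\<close>, a column of \<open>\<nu>\<close> contains
  at most one label from each row of \<open>\<mu>\<close>. So it contains at most \<open>k\<close> labels from the first \<open>k\<close> rows
  of \<open>\<mu>\<close>, and not more than its length. The minimum of the two numbers is the number of its cells in
  the first \<open>k\<close> rows of \<open>\<nu>\<close>.\<close>

lemma dominance:
  assumes \<nu>: "\<nu> \<in> partitions n" and \<mu>: "\<mu> \<in> compositions n" and g: "g \<in> perms {1..n}"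
    and inj: "\<And>x y. x \<in> {1..n} \<Longrightarrow> y \<in> {1..n} \<Longrightarrow> cell_row \<mu> x = cell_row \<mu> y \<Longrightarrow>
      cell_col \<nu> (act g x) = cell_col \<nu> (act g y) \<Longrightarrow> x = y"
  shows "card {x \<in> {1..n}. cell_row \<mu> x < k} \<le> card {x \<in> {1..n}. cell_row \<nu> x < k}"
proof -
  let ?X = "{1..n}"
  note comp = partition_composition[OF \<nu>]
  define J where "J = cell_col \<nu> ` ?X"
  define F where "F j = {x \<in> {x \<in> ?X. cell_row \<mu> x < k}. cell_col \<nu> (act g x) = j}" for j
  define D where "D j = {y \<in> {y \<in> ?X. cell_row \<nu> y < k}. cell_col \<nu> y = j}" for j
  have fin: "finite (F j)" "finite (D j)" for j
    by (auto simp: F_def D_def)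
  have "card (F j) \<le> card (D j)" for j
  proof (cases "\<forall>y\<in>?X. cell_col \<nu> y = j \<longrightarrow> cell_row \<nu> y < k")
    case True
    have "act g ` F j \<subseteq> D j"
      using True perms_act_mem[OF g] by (auto simp: F_def D_def simp del: atLeastAtMost_iff)
    moreover have "inj_on (act g) (F j)"
      by (rule inj_on_subset[OF bij_is_inj]) auto
    ultimately show ?thesis
      using fin by (intro card_inj_on_le)
  next
    case False
    then obtain y where y: "y \<in> ?X" "cell_col \<nu> y = j" "k \<le> cell_row \<nu> y" by auto
    have "inj_on (cell_row \<mu>) (F j)"
      by (rule inj_onI) (use inj in \<open>auto simp: F_def simp del: atLeastAtMost_iff\<close>)
    then have "card (F j) \<le> card {..<k}"
      by (rule card_inj_on_le) (auto simp: F_def)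
    also have "{..<k} \<subseteq> cell_row \<nu> ` D j"
    proof
      fix i assume i: "i \<in> {..<k}"
      then have "(i, j) \<in> diagram \<nu>"
        using partition_diagram_down[OF \<nu> row_col_in_diagram[OF comp y(1)], of i] y by auto
      then obtain x where "x \<in> ?X" "cell_row \<nu> x = i" "cell_col \<nu> x = j"
        by (rule row_col_surj[OF comp])
      then show "i \<in> cell_row \<nu> ` D j" using i by (auto simp: D_def)
    qed
    then have "card {..<k} \<le> card (D j)"
      by (rule surj_card_le[OF fin(2)])
    finally show ?thesis .
  qed
  then have "(\<Sum>j\<in>J. card (F j)) \<le> (\<Sum>j\<in>J. card (D j))"
    by (rule sum_mono)
  moreover have "card {x \<in> ?X. cell_row \<mu> x < k} = (\<Sum>j\<in>J. card (F j))"
    unfolding F_def J_def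
    by (rule card_fibres) (use perms_act_mem[OF g] in \<open>auto simp del: atLeastAtMost_iff\<close>)
  moreover have "card {x \<in> ?X. cell_row \<nu> x < k} = (\<Sum>j\<in>J. card (D j))"
    unfolding D_def J_def by (rule card_fibres) auto
  ultimately show ?thesis by simp
qed

lemma composition_eqI:
  assumes \<nu>: "\<nu> \<in> compositions n" and \<mu>: "\<mu> \<in> compositions n"
    and eq: "\<And>k. card {x \<in> {1..n}. cell_row \<nu> x < k} = card {x \<in> {1..n}. cell_row \<mu> x < k}"
  shows "\<nu> = \<mu>"
proof -
  have diff: "card {x \<in> {1..n}. cell_row \<alpha> x = k} =
      card {x \<in> {1..n}. cell_row \<alpha> x < Suc k} - card {x \<in> {1..n}. cell_row \<alpha> x < k}" for \<alpha> k
  proof -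
    have *: "{x \<in> {1..n}. cell_row \<alpha> x = k} = {x \<in> {1..n}. cell_row \<alpha> x < Suc k} - {x \<in> {1..n}. cell_row \<alpha> x < k}"
      by auto
    show ?thesis
      unfolding * by (rule card_Diff_subset) auto
  qed
  define c where "c k = card {x \<in> {1..n}. cell_row \<nu> x = k}" for k
  have c: "c k = (if k < length \<alpha> then \<alpha> ! k else 0)" if "\<alpha> = \<nu> \<or> \<alpha> = \<mu>" for k \<alpha>
  proof -
    have \<alpha>: "\<alpha> \<in> compositions n"
      using that \<nu> \<mu> by auto
    moreover have "c k = card {x \<in> {1..n}. cell_row \<alpha> x = k}"
      using that by (auto simp only: diff c_def eq)
    moreover have "cell_row \<alpha> x < length \<alpha>" if "x \<in> {1..n}" for x
      using row_col_in_diagram[OF \<alpha> that] by (simp add: diagram_def)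
    then have "{x \<in> {1..n}. cell_row \<alpha> x = k} = {}" if "\<not> k < length \<alpha>"
      using that by blast
    ultimately show ?thesis
      using card_row[OF \<alpha>] by auto
  qed
  have pos: "c k > 0 \<longleftrightarrow> k < length \<alpha>" if "\<alpha> = \<nu> \<or> \<alpha> = \<mu>" for k \<alpha>
  proof -
    have "\<alpha> \<in> compositions n" using that \<nu> \<mu> by auto
    then have "0 < \<alpha> ! k" if "k < length \<alpha>" using that by (simp add: compositions_def)
    then show ?thesis unfolding c[OF that, of k] by simp
  qed
  have "k < length \<nu> \<longleftrightarrow> k < length \<mu>" for k
    using pos by blast
  then have len: "length \<nu> = length \<mu>"
    by (metis linorder_neqE_nat less_irrefl)
  then show ?thesis
  proof (rule nth_equalityI)
    fix i assume "i < length \<nu>"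
    then show "\<nu> ! i = \<mu> ! i"
      using c[of \<nu> i] c[of \<mu> i] len by simp
  qed
qed

text \<open>Up to a scalar, this is the central idempotent of the block that belongs to \<open>\<alpha>\<close>.\<close>

definition class_average :: "nat list \<Rightarrow> grpalg" where
  "class_average \<alpha> = (\<Sum>g\<in>perms {1..sum_list \<alpha>}. \<delta> g * young \<alpha> * \<delta> (- g))"

lemma class_average_eq: "\<alpha> \<in> partitions n \<Longrightarrow>
    class_average \<alpha> = (\<Sum>g\<in>perms {1..n}. \<delta> g * young \<alpha> * \<delta> (- g))"
  by (simp add: class_average_def partitions_def compositions_def)

lemma supported_sum: "(\<And>i. i \<in> I \<Longrightarrow> x i \<in> supported X) \<Longrightarrow> (\<Sum>i\<in>I. x i) \<in> supported X"
proof -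
  assume *: "\<And>i. i \<in> I \<Longrightarrow> x i \<in> supported X"
  have "coef (\<Sum>i\<in>I. x i) g = 0" if "g \<notin> perms X" for g
    using * that by (auto simp: lookup_sum supported_def in_keys_iff subset_iff intro!: sum.neutral)
  then show ?thesis by (auto simp: supported_def in_keys_iff)
qed

lemma supported_scale: "x \<in> supported X \<Longrightarrow> c *\<^sub>S x \<in> supported X"
  by (auto simp: supported_def in_keys_iff)

lemma supported_mult: "x \<in> supported X \<Longrightarrow> y \<in> supported X \<Longrightarrow> x * y \<in> supported X"
  using keys_mult[of x y] by (fastforce simp: supported_def)

lemma supported_young: "\<alpha> \<in> compositions n \<Longrightarrow> young \<alpha> \<in> supported {1..n}"
  unfolding young_eq alt_sum_def sym_sum_def
  by (intro supported_mult supported_sum supported_scale supported_delta)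
    (auto simp: stab_def)

lemma supported_class_average: "\<alpha> \<in> partitions n \<Longrightarrow> class_average \<alpha> \<in> supported {1..n}"
  unfolding class_average_eq
  by (intro supported_sum supported_mult supported_delta supported_young) (auto simp: partition_composition)

lemma coef_delta_mult: "coef (\<delta> h * x) k = coef x (- h + k)"
proof -
  have "coef (\<delta> h * x) k = (\<Sum>g\<in>Poly_Mapping.keys x. coef x g * coef (\<delta> (h + g)) k)"
    by (subst expand_delta[of x]) (simp add: sum_distrib_left mult_scale_right delta_mult lookup_sum)
  also have "\<dots> = (\<Sum>g\<in>Poly_Mapping.keys x. if g = - h + k then coef x g else 0)"
    by (intro sum.cong refl) (auto simp: lookup_single when_def eq_diff_eq add.assoc[symmetric])
  finally show ?thesis
    by (simp add: in_keys_iff)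
qed

lemma coef_mult_delta: "coef (x * \<delta> h) k = coef x (k - h)"
proof -
  have "coef (x * \<delta> h) k = (\<Sum>g\<in>Poly_Mapping.keys x. coef x g * coef (\<delta> (g + h)) k)"
    by (subst expand_delta[of x]) (simp add: sum_distrib_right scale_mult_left delta_mult lookup_sum)
  also have "\<dots> = (\<Sum>g\<in>Poly_Mapping.keys x. if g = k - h then coef x g else 0)"
    by (intro sum.cong refl) (auto simp: lookup_single when_def)
  finally show ?thesis
    by (simp add: in_keys_iff)
qed

lemma coef_mult:
  assumes "finite X" "x \<in> supported X"
  shows "coef (x * y) k = (\<Sum>g\<in>perms X. coef x g * coef y (- g + k))"
proof -
  have "x = (\<Sum>g\<in>perms X. coef x g *\<^sub>S \<delta> g)"
    using assms by (intro expand_delta_superset) (auto simp: supported_def)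
  then have "x * y = (\<Sum>g\<in>perms X. coef x g *\<^sub>S (\<delta> g * y))"
    by (metis (no_types, lifting) scale_mult_left sum.cong sum_distrib_right)
  then show ?thesis
    by (simp add: lookup_sum coef_delta_mult)
qed

text \<open>Conjugation by \<open>h\<close> only permutes the summands. Hence the coefficients are
  constant on conjugacy classes and the element is central.\<close>

lemma class_average_conjugate:
  assumes "\<alpha> \<in> partitions n" "h \<in> perms {1..n}"
  shows "\<delta> h * class_average \<alpha> * \<delta> (- h) = class_average \<alpha>"
proof -
  have "\<delta> h * class_average \<alpha> * \<delta> (- h) = (\<Sum>g\<in>perms {1..n}. \<delta> (h + g) * young \<alpha> * \<delta> (- (h + g)))"
    unfolding class_average_eq[OF assms(1)]
    by (simp only: sum_distrib_left sum_distrib_right minus_add delta_mult[symmetric] mult.assoc)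
  also have "\<dots> = class_average \<alpha>"
    unfolding class_average_eq[OF assms(1)]
    by (rule subgrp_sum_left[OF subgrp_perms[of "{1..n}"]]) (use assms in auto)
  finally show ?thesis .
qed

lemma coef_class_average_conjugate:
  assumes "\<alpha> \<in> partitions n" "h \<in> perms {1..n}"
  shows "coef (class_average \<alpha>) (h + g - h) = coef (class_average \<alpha>) g"
proof -
  have "coef (class_average \<alpha>) (h + g - h) = coef (\<delta> h * class_average \<alpha> * \<delta> (- h)) (h + g - h)"
    using class_average_conjugate[OF assms] by simp
  also have "\<dots> = coef (class_average \<alpha>) g"
    by (simp add: coef_mult_delta coef_delta_mult add.assoc[symmetric])
  finally show ?thesis .
qed

lemma class_average_commute:
  assumes "\<alpha> \<in> partitions n" "x \<in> supported {1..n}"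
  shows "x * class_average \<alpha> = class_average \<alpha> * x"
proof -
  have *: "\<delta> h * class_average \<alpha> = class_average \<alpha> * \<delta> h" if "h \<in> perms {1..n}" for h
  proof -
    have "\<delta> h * class_average \<alpha> = \<delta> h * class_average \<alpha> * (\<delta> (- h) * \<delta> h)"
      by (simp add: delta_mult)
    also have "\<dots> = class_average \<alpha> * \<delta> h"
      using class_average_conjugate[OF assms(1) that] by (simp add: mult.assoc[symmetric])
    finally show ?thesis .
  qed
  show ?thesis
    by (subst (1 2) expand_delta_superset[of "perms {1..n}" x])
      (use assms in \<open>auto simp: supported_def sum_distrib_left sum_distrib_right scale_mult_left mult_scale_right * 
        simp del: atLeastAtMost_iff intro!: sum.cong\<close>)
qed

text \<open>A permutation that preserves both row and column of each label is the identity, so that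
  the identity arises only once in the product. Consequently \<open>class_average \<alpha>\<close> is nonzero.\<close>

lemma coef_young_0:
  assumes \<alpha>: "\<alpha> \<in> compositions n"
  shows "coef (young \<alpha>) 0 = 1"
proof -
  let ?X = "{1..n}"
  let ?R = "stab ?X (cell_row \<alpha>)" and ?C = "stab ?X (cell_col \<alpha>)"
  have fin: "finite ?R" "finite ?C" and 0: "0 \<in> ?R" "0 \<in> ?C"
    by (auto simp: stab_def)
  have triv: "r = 0" if r: "r \<in> ?R" and c: "c \<in> ?C" and rc: "r + c = 0" for r c
  proof (rule nat_perm_eqI)
    have "r = - c" using rc by (simp add: eq_neg_iff_add_eq_0)
    then have "r \<in> ?C" using c subgrp_stab[of ?X "cell_col \<alpha>"] by (auto simp: subgrp_def)
    then show "act r x = act 0 x" for x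
      using r row_col_inj[OF \<alpha>, of "act r x" x]
      by (cases "x \<in> ?X") (auto simp: stab_def perms_act_mem perms_def permutes_not_in simp del: atLeastAtMost_iff)
  qed
  have "young \<alpha> = (\<Sum>r\<in>?R. \<Sum>c\<in>?C. sg r *\<^sub>S \<delta> (r + c))"
    by (simp add: young_eq[OF \<alpha>] alt_sum_def sym_sum_def sum_distrib_left sum_distrib_right
        scale_mult_left delta_mult)
      (rule sum.swap)
  then have "coef (young \<alpha>) 0 = (\<Sum>r\<in>?R. \<Sum>c\<in>?C. sg r * (if r + c = 0 then 1 else 0))"
    by (simp add: lookup_sum lookup_single when_def)
  also have "\<dots> = (\<Sum>r\<in>?R. \<Sum>c\<in>?C. if r = 0 then (if c = 0 then 1 else 0) else 0)"
    using triv by (intro sum.cong refl) (auto simp: add_eq_0_iff2)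
  also have "\<dots> = (\<Sum>r\<in>?R. if r = 0 then \<Sum>c\<in>?C. (if c = 0 then 1 else 0) else 0)"
    by (intro sum.cong refl) auto
  also have "\<dots> = 1"
    using fin 0 by (simp add: sum.delta)
  finally show ?thesis .
qed

lemma coef_young_real: "\<alpha> \<in> compositions n \<Longrightarrow> coef (young \<alpha>) g \<in> \<real>"
  by (auto simp: young_eq alt_sum_def sym_sum_def sum_distrib_left sum_distrib_right scale_mult_left
      delta_mult lookup_sum lookup_single when_def sg_def intro!: sum_in_Reals)

lemma coef_class_average_real: "\<alpha> \<in> partitions n \<Longrightarrow> coef (class_average \<alpha>) g \<in> \<real>"
  by (auto simp: class_average_eq lookup_sum coef_mult_delta coef_delta_mult
      intro!: sum_in_Reals coef_young_real partition_composition)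

lemma coef_class_average_0: "\<alpha> \<in> partitions n \<Longrightarrow> coef (class_average \<alpha>) 0 = of_nat (card (perms {1..n}))"
  by (simp add: class_average_eq lookup_sum coef_mult_delta coef_delta_mult coef_young_0[OF partition_composition])

text \<open>If the product were nonzero, then some \<open>S * \<delta> g * A'\<close> with \<open>S\<close> from \<open>\<nu>\<close> and \<open>A'\<close> from \<open>\<mu>\<close> would
  be nonzero, and by centrality also one with the roles exchanged. Then the shapes dominate each
  other, and are equal.\<close>

lemma class_average_mult_class_average_eq_0:
  assumes \<nu>: "\<nu> \<in> partitions n" and \<mu>: "\<mu> \<in> partitions n" and neq: "\<nu> \<noteq> \<mu>"
  shows "class_average \<nu> * class_average \<mu> = 0"
proof -
  let ?X = "{1..n}"
  have product: "class_average \<alpha> * class_average \<beta> = 0"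
    if "\<alpha> \<in> partitions n" "\<beta> \<in> partitions n"
      and zero: "\<And>g. g \<in> perms ?X \<Longrightarrow> sym_sum (stab ?X (cell_col \<alpha>)) * (\<delta> g * alt_sum (stab ?X (cell_row \<beta>))) = 0"
    for \<alpha> \<beta>
  proof -
    have "young \<alpha> * \<delta> g * young \<beta> = 0" if "g \<in> perms ?X" for g
      using zero[OF that] that \<open>\<alpha> \<in> _\<close> \<open>\<beta> \<in> _\<close>
      by (simp add: young_eq[OF partition_composition] mult.assoc)
        (simp add: mult.assoc[symmetric])
    then have "\<delta> g * young \<alpha> * \<delta> (- g) * (\<delta> h * young \<beta> * \<delta> (- h)) = 0"
      if "g \<in> perms ?X" "h \<in> perms ?X" for g h
    proof -
      have "\<delta> g * young \<alpha> * \<delta> (- g) * (\<delta> h * young \<beta> * \<delta> (- h)) =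
          \<delta> g * (young \<alpha> * \<delta> (- g + h) * young \<beta>) * \<delta> (- h)"
        by (simp only: delta_mult[symmetric] mult.assoc)
      also have "\<dots> = 0"
        using \<open>\<And>g. g \<in> perms ?X \<Longrightarrow> young \<alpha> * \<delta> g * young \<beta> = 0\<close> that by simp
      finally show ?thesis .
    qed
    then show ?thesis
      using that by (simp add: class_average_eq sum_product)
  qed
  have dom: "card {x \<in> ?X. cell_row \<beta> x < k} \<le> card {x \<in> ?X. cell_row \<alpha> x < k}"
    if "\<alpha> \<in> partitions n" "\<beta> \<in> partitions n" "g \<in> perms ?X"
      "sym_sum (stab ?X (cell_col \<alpha>)) * (\<delta> g * alt_sum (stab ?X (cell_row \<beta>))) \<noteq> 0" for \<alpha> \<beta> g k
    using that sym_delta_alt_eq_0[of ?X g _ _ "cell_row \<beta>" "cell_col \<alpha>"]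
    by (intro dominance) (auto simp: partition_composition)
  show ?thesis
  proof (rule ccontr)
    assume nz: "\<not> ?thesis"
    then obtain g where "g \<in> perms ?X"
      "sym_sum (stab ?X (cell_col \<nu>)) * (\<delta> g * alt_sum (stab ?X (cell_row \<mu>))) \<noteq> 0"
      using product[OF \<nu> \<mu>] by blast
    note 1 = dom[OF \<nu> \<mu> this]
    have "class_average \<mu> * class_average \<nu> \<noteq> 0"
      using nz class_average_commute[OF \<mu> supported_class_average[OF \<nu>]] by simp
    then obtain h where "h \<in> perms ?X"
      "sym_sum (stab ?X (cell_col \<mu>)) * (\<delta> h * alt_sum (stab ?X (cell_row \<nu>))) \<noteq> 0"
      using product[OF \<mu> \<nu>] by blast
    note 2 = dom[OF \<mu> \<nu> this]
    have "card {x \<in> ?X. cell_row \<nu> x < k} = card {x \<in> ?X. cell_row \<mu> x < k}" for k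
      using 1[of k] 2[of k] by (rule order_antisym[rotated])
    then have "\<nu> = \<mu>"
      using \<nu> \<mu> by (intro composition_eqI) (auto simp: partition_composition)
    with neq show False ..
  qed
qed

section \<open>Cycle types and conjugacy\<close>

lemma conjugate_of_normal_form:
  assumes p: "p permutes X" and q: "q permutes X"
    and T: "bij_betw T D X" and T': "bij_betw T' D X"
    and \<sigma>: "\<And>u. u \<in> D \<Longrightarrow> \<sigma> u \<in> D"
    and pT: "\<And>u. u \<in> D \<Longrightarrow> p (T u) = T (\<sigma> u)"
    and qT': "\<And>u. u \<in> D \<Longrightarrow> q (T' u) = T' (\<sigma> u)"
  shows "\<exists>k. k permutes X \<and> q \<circ> k = k \<circ> p"
proof -
  define k where "k x = (if x \<in> X then T' (inv_into D T x) else x)" for x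
  have kT: "k (T u) = T' u" if "u \<in> D" for u
    using that T by (simp add: k_def bij_betw_inv_into_left bij_betwE)
  have "bij_betw (T' \<circ> inv_into D T) X X"
    by (rule bij_betw_trans[OF bij_betw_inv_into[OF T] T'])
  then have "bij_betw k X X"
    by (rule bij_betw_cong[THEN iffD1, rotated]) (simp add: k_def)
  then have "k permutes X"
    by (rule bij_imp_permutes) (simp add: k_def)
  moreover have "q (k x) = k (p x)" for x
  proof (cases "x \<in> X")
    case True
    then obtain u where "u \<in> D" "x = T u"
      using bij_betw_imp_surj_on[OF T] by blast
    then show ?thesis
      using \<sigma> by (simp add: kT pT qT')
  next
    case False
    then show ?thesis
      using p q by (simp add: k_def permutes_not_in)
  qed
  ultimately show ?thesis
    by (auto simp: fun_eq_iff)
qed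

text \<open>A permutation of cycle type \<open>\<alpha>\<close> is, up to relabelling, the map that rotates each row of the
  diagram of \<open>\<alpha>\<close> by one step. Flipping the rows turns it into its inverse.\<close>

definition row_shift :: "nat list \<Rightarrow> nat \<times> nat \<Rightarrow> nat \<times> nat" where
  "row_shift \<alpha> = (\<lambda>(i, j). (i, Suc j mod \<alpha> ! i))"

definition row_flip :: "nat list \<Rightarrow> nat \<times> nat \<Rightarrow> nat \<times> nat" where
  "row_flip \<alpha> = (\<lambda>(i, j). (i, \<alpha> ! i - Suc j))"

lemma row_shift_in_diagram: "u \<in> diagram \<alpha> \<Longrightarrow> row_shift \<alpha> u \<in> diagram \<alpha>"
  by (auto simp: row_shift_def diagram_def)

lemma row_flip_in_diagram: "u \<in> diagram \<alpha> \<Longrightarrow> row_flip \<alpha> u \<in> diagram \<alpha>"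
  by (auto simp: row_flip_def diagram_def)

lemma row_flip_flip: "u \<in> diagram \<alpha> \<Longrightarrow> row_flip \<alpha> (row_flip \<alpha> u) = u"
  by (auto simp: row_flip_def diagram_def)

lemma row_shift_flip_shift:
  assumes "u \<in> diagram \<alpha>"
  shows "row_shift \<alpha> (row_flip \<alpha> (row_shift \<alpha> u)) = row_flip \<alpha> u"
proof -
  obtain i j where u: "u = (i, j)" "j < \<alpha> ! i"
    using assms by (auto simp: diagram_def)
  show ?thesis
  proof (cases "Suc j = \<alpha> ! i")
    case True
    then show ?thesis by (auto simp: u row_shift_def row_flip_def)
  next
    case False
    then have "Suc j < \<alpha> ! i" using u by simp
    then show ?thesis by (simp add: u row_shift_def row_flip_def Suc_diff_Suc)
  qed
qed

lemma orbit_cycle: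
  assumes "finite X" "p permutes X" "x \<in> X"
  shows "bij_betw (\<lambda>j. (p ^^ j) x) {..<card (orbit p x)} (orbit p x)"
    and "(p ^^ card (orbit p x)) x = x"
proof -
  have self: "x \<in> orbit p x"
    using assms by (intro permutation_self_in_orbit) (auto simp: permutation_permutes)
  have "bij_betw (\<lambda>j. (p ^^ j) x) {0..<funpow_dist1 p x x} (orbit p x)"
    unfolding bij_betw_def using inj_on_funpow_dist1[OF self] orbit_conv_funpow_dist1[OF self] by simp
  moreover from bij_betw_same_card[OF this] have "card (orbit p x) = funpow_dist1 p x x"
    by simp
  ultimately show "bij_betw (\<lambda>j. (p ^^ j) x) {..<card (orbit p x)} (orbit p x)"
    "(p ^^ card (orbit p x)) x = x"
    using funpow_dist1_prop[OF self] by (simp_all add: lessThan_atLeast0 del: funpow.simps)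
qed

text \<open>The rows of the diagram are the orbits in order of decreasing size; each is listed by
  iterating the permutation from a base point.\<close>

lemma normal_form_exists:
  assumes X: "finite X" and p: "p permutes X"
  shows "\<exists>\<alpha>\<in>partitions (card X). \<exists>T. bij_betw T (diagram \<alpha>) X \<and>
    (\<forall>u\<in>diagram \<alpha>. p (T u) = T (row_shift \<alpha> u))"
proof -
  define Orb where "Orb = orbit p ` X"
  obtain xs where xs: "set xs = Orb" "distinct xs"
    using finite_distinct_list[of Orb] X by (auto simp: Orb_def)
  define ys where "ys = rev (sort_key card xs)"
  have ys: "set ys = Orb" "distinct ys"
    using xs by (simp_all add: ys_def)
  define \<alpha> where "\<alpha> = map card ys"
  define base where "base O' = (SOME x. x \<in> X \<and> O' = orbit p x)" for O'
  have base: "base (ys ! i) \<in> X" "orbit p (base (ys ! i)) = ys ! i" if "i < length ys" for i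
  proof -
    have "\<exists>x. x \<in> X \<and> ys ! i = orbit p x"
      using that ys(1) nth_mem[OF that] by (auto simp: Orb_def)
    from someI_ex[OF this] show "base (ys ! i) \<in> X" "orbit p (base (ys ! i)) = ys ! i"
      by (auto simp: base_def)
  qed
  define T where "T = (\<lambda>(i, j). (p ^^ j) (base (ys ! i)))"
  have row: "bij_betw (\<lambda>j. T (i, j)) {..<\<alpha> ! i} (ys ! i)" "(p ^^ (\<alpha> ! i)) (base (ys ! i)) = base (ys ! i)"
    if "i < length ys" for i
    using orbit_cycle[OF X p base(1)[OF that]] that by (auto simp: T_def \<alpha>_def base(2))
  have disjoint: "i = i'" if "x \<in> ys ! i" "x \<in> ys ! i'" "i < length ys" "i' < length ys" for i i' x
  proof -
    have "ys ! k = orbit p x" if "x \<in> ys ! k" "k < length ys" for k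
      using orbit_cyclic_eq3[OF cyclic_on_orbit[OF p X]] base(2)[OF that(2)] that(1) by metis
    then have "ys ! i = ys ! i'" using that by metis
    then show ?thesis using nth_eq_iff_index_eq[OF ys(2)] that by blast
  qed
  have "inj_on T (diagram \<alpha>)"
  proof (rule inj_onI)
    fix u v assume uv: "u \<in> diagram \<alpha>" "v \<in> diagram \<alpha>" "T u = T v"
    obtain i j i' j' where eq: "u = (i, j)" "v = (i', j')" by fastforce
    have len: "i < length ys" "i' < length ys" "j < \<alpha> ! i" "j' < \<alpha> ! i'"
      using uv by (auto simp: eq diagram_def \<alpha>_def)
    have "T u \<in> ys ! i" "T v \<in> ys ! i'"
      using bij_betwE[OF row(1)] len by (auto simp: eq)
    then have "i = i'" using disjoint[of "T u" i i'] uv len by simp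
    then show "u = v"
      using inj_onD[OF bij_betw_imp_inj_on[OF row(1)[OF len(1)]], of j j'] uv len by (simp add: eq)
  qed
  moreover have "T ` diagram \<alpha> = X"
  proof (intro equalityI subsetI)
    fix x assume "x \<in> T ` diagram \<alpha>"
    then obtain i j where ij: "i < length ys" "j < \<alpha> ! i" "x = T (i, j)"
      by (auto simp: diagram_def \<alpha>_def)
    then have "x \<in> orbit p (base (ys ! i))"
      using bij_betwE[OF row(1)[OF ij(1)]] base(2)[OF ij(1)] by auto
    then show "x \<in> X" using permutes_orbit_subset[OF p base(1)[OF ij(1)]] by auto
  next
    fix x assume x: "x \<in> X"
    then have "orbit p x \<in> set ys" by (simp add: ys Orb_def)
    then obtain i where i: "i < length ys" "ys ! i = orbit p x"
      by (auto simp: in_set_conv_nth)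
    have "x \<in> orbit p x"
      using X p by (intro permutation_self_in_orbit) (auto simp: permutation_permutes)
    then have "x \<in> (\<lambda>j. T (i, j)) ` {..<\<alpha> ! i}"
      using bij_betw_imp_surj_on[OF row(1)[OF i(1)]] i by simp
    then show "x \<in> T ` diagram \<alpha>"
      using i by (auto simp: diagram_def \<alpha>_def)
  qed
  ultimately have bij: "bij_betw T (diagram \<alpha>) X"
    by (simp add: bij_betw_def)
  have "\<alpha> \<in> partitions (card X)"
    unfolding partitions_def compositions_def
  proof (intro CollectI conjI ballI)
    show "sum_list \<alpha> = card X"
      using bij_betw_same_card[OF bij] by (simp add: card_diagram)
    show "sorted_wrt (\<ge>) \<alpha>"
      by (simp add: \<alpha>_def ys_def rev_map[symmetric] sorted_wrt_rev)
  next
    fix a assume a: "a \<in> set \<alpha>"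
    show "0 < a"
    proof -
      obtain x where "x \<in> X" "a = card (orbit p x)"
        using a by (auto simp: \<alpha>_def ys Orb_def)
      then show ?thesis
        using finite_subset[OF permutes_orbit_subset[OF p] X] by (simp add: card_gt_0_iff orbit_nonempty)
    qed
  qed
  moreover have "p (T u) = T (row_shift \<alpha> u)" if u_in: "u \<in> diagram \<alpha>" for u
  proof -
    obtain i j where u: "u = (i, j)" "i < length ys" "j < \<alpha> ! i"
      using u_in by (auto simp: diagram_def \<alpha>_def)
    show ?thesis
    proof (cases "Suc j = \<alpha> ! i")
      case True
      have "p ((p ^^ j) (base (ys ! i))) = base (ys ! i)"
        using row(2)[OF u(2)] unfolding True[symmetric] by simp
      then show ?thesis using True by (simp add: u T_def row_shift_def)
    next
      case False
      then have "Suc j < \<alpha> ! i" using u by simp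
      then show ?thesis by (simp add: u T_def row_shift_def)
    qed
  qed
  ultimately show ?thesis using bij by blast
qed

lemma conjugate_permsI:
  assumes "g \<in> perms X" "h \<in> perms X" "\<exists>k. k permutes X \<and> act h \<circ> k = k \<circ> act g"
  shows "\<exists>k\<in>perms X. h = k + g - k"
proof -
  obtain k where k: "k permutes X" "act h \<circ> k = k \<circ> act g" using assms(3) by blast
  have "h + Perm k = Perm k + g"
    using k by (intro nat_perm_eqI) (simp add: permutes_bij fun_eq_iff)
  then have "h = Perm k + g - Perm k" by (metis add_diff_cancel)
  then show ?thesis using Perm_in_perms[OF k(1)] by blast
qed

lemma cycle_type_exists:
  obtains \<tau> where "\<And>g. g \<in> perms {1..n} \<Longrightarrow> \<tau> g \<in> partitions n"
    "\<And>g h. g \<in> perms {1..n} \<Longrightarrow> h \<in> perms {1..n} \<Longrightarrow> \<tau> g = \<tau> h \<Longrightarrow> \<exists>k\<in>perms {1..n}. h = k + g - k"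
proof -
  let ?P = "\<lambda>g \<alpha>. \<alpha> \<in> partitions n \<and> (\<exists>T. bij_betw T (diagram \<alpha>) {1..n} \<and>
    (\<forall>u\<in>diagram \<alpha>. act g (T u) = T (row_shift \<alpha> u)))"
  define \<tau> where "\<tau> g = (SOME \<alpha>. ?P g \<alpha>)" for g
  have \<tau>: "?P g (\<tau> g)" if "g \<in> perms {1..n}" for g
  proof -
    have "\<exists>\<alpha>. ?P g \<alpha>"
      using normal_form_exists[of "{1..n}" "act g"] that by (auto simp: perms_def)
    then show ?thesis unfolding \<tau>_def by (rule someI_ex)
  qed
  show thesis
  proof (rule that)
    show "\<tau> g \<in> partitions n" if "g \<in> perms {1..n}" for g
      using \<tau>[OF that] by blast
    fix g h assume gh: "g \<in> perms {1..n}" "h \<in> perms {1..n}" and eq: "\<tau> g = \<tau> h"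
    obtain T where T: "bij_betw T (diagram (\<tau> g)) {1..n}"
      "\<And>u. u\<in>diagram (\<tau> g) \<Longrightarrow> act g (T u) = T (row_shift (\<tau> g) u)"
      using \<tau>[OF gh(1)] by blast
    obtain T' where T': "bij_betw T' (diagram (\<tau> g)) {1..n}"
      "\<And>u. u\<in>diagram (\<tau> g) \<Longrightarrow> act h (T' u) = T' (row_shift (\<tau> g) u)"
      using \<tau>[OF gh(2)] unfolding eq[symmetric] by blast
    show "\<exists>k\<in>perms {1..n}. h = k + g - k"
      using conjugate_of_normal_form[where \<sigma> = "row_shift (\<tau> g)" and p = "act g" and q = "act h",
          OF _ _ T(1) T'(1) row_shift_in_diagram T(2) T'(2)] gh
      by (intro conjugate_permsI) (auto simp: perms_def)
  qed
qed

lemma conjugate_uminus: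
  assumes "g \<in> perms {1..n}"
  shows "\<exists>k\<in>perms {1..n}. - g = k + g - k"
proof -
  obtain \<alpha> T where T: "bij_betw T (diagram \<alpha>) {1..n}"
    "\<And>u. u \<in> diagram \<alpha> \<Longrightarrow> act g (T u) = T (row_shift \<alpha> u)"
    using normal_form_exists[of "{1..n}" "act g"] assms by (auto simp: perms_def)
  have "bij_betw (row_flip \<alpha>) (diagram \<alpha>) (diagram \<alpha>)"
    by (rule bij_betw_byWitness[where f' = "row_flip \<alpha>"])
      (auto simp: row_flip_flip row_flip_in_diagram)
  then have T': "bij_betw (T \<circ> row_flip \<alpha>) (diagram \<alpha>) {1..n}"
    using T(1) by (rule bij_betw_trans)
  have "act (- g) ((T \<circ> row_flip \<alpha>) u) = (T \<circ> row_flip \<alpha>) (row_shift \<alpha> u)" if "u \<in> diagram \<alpha>" for u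
  proof -
    have "act g (T (row_flip \<alpha> (row_shift \<alpha> u))) = T (row_flip \<alpha> u)"
      using that by (simp add: T(2) row_flip_in_diagram row_shift_in_diagram row_shift_flip_shift)
    then show ?thesis
      by (simp add: inv_f_eq[OF bij_is_inj])
  qed
  from conjugate_of_normal_form[where \<sigma> = "row_shift \<alpha>" and p = "act g" and q = "act (- g)",
      OF _ _ T(1) T' row_shift_in_diagram T(2) this]
  show ?thesis
    using assms perms_closed(3)[OF assms] by (intro conjugate_permsI) (auto simp: perms_def)
qed

section \<open>Faithfulness\<close>

text \<open>Since a permutation is conjugate to its inverse, the coefficient of the square at the
  identity is the sum of the squares of the coefficients. They are real and not all zero.\<close>

lemma class_average_square_nonzero:
  assumes \<alpha>: "\<alpha> \<in> partitions n"
  shows "class_average \<alpha> * class_average \<alpha> \<noteq> 0"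
proof -
  let ?c = "\<lambda>g. Re (coef (class_average \<alpha>) g)"
  have c: "coef (class_average \<alpha>) g = of_real (?c g)" for g
    using coef_class_average_real[OF \<alpha>, of g] by (auto simp: Reals_def)
  have "coef (class_average \<alpha> * class_average \<alpha>) 0 = (\<Sum>g\<in>perms {1..n}. of_real ((?c g)\<^sup>2))"
  proof (subst coef_mult[OF _ supported_class_average[OF \<alpha>]], simp, unfold add_0_right, intro sum.cong refl)
    fix g assume g: "g \<in> perms {1..n}"
    have "coef (class_average \<alpha>) (- g) = coef (class_average \<alpha>) g"
      using conjugate_uminus[OF g] coef_class_average_conjugate[OF \<alpha>] by metis
    then show "coef (class_average \<alpha>) g * coef (class_average \<alpha>) (- g) = of_real ((?c g)\<^sup>2)"
      by (metis c of_real_mult power2_eq_square)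
  qed
  also have "\<dots> = of_real (\<Sum>g\<in>perms {1..n}. (?c g)\<^sup>2)"
    by simp
  finally have "coef (class_average \<alpha> * class_average \<alpha>) 0 = of_real (\<Sum>g\<in>perms {1..n}. (?c g)\<^sup>2)" .
  moreover have "(\<Sum>g\<in>perms {1..n}. (?c g)\<^sup>2) > 0"
  proof (rule sum_pos2[of _ 0])
    have "card (perms {1..n}) \<noteq> 0"
      using perms_closed(1)[of "{1..n}"] card_0_eq[OF finite_perms] by blast
    then show "0 < (?c 0)\<^sup>2"
      by (simp add: coef_class_average_0[OF \<alpha>])
  qed auto
  ultimately show ?thesis
    by (auto simp del: of_real_sum of_real_power)
qed

lemma class_function_in_span:
  assumes n: "\<And>g. g \<in> perms {1..n} \<Longrightarrow> \<tau> g \<in> partitions n"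
    and conj: "\<And>g h. g \<in> perms {1..n} \<Longrightarrow> h \<in> perms {1..n} \<Longrightarrow> \<tau> g = \<tau> h \<Longrightarrow>
      \<exists>k\<in>perms {1..n}. h = k + g - k"
    and x: "x \<in> supported {1..n}"
    and cls: "\<And>g k. g \<in> perms {1..n} \<Longrightarrow> k \<in> perms {1..n} \<Longrightarrow> coef x (k + g - k) = coef x g"
  shows "x \<in> GA.span ((\<lambda>\<alpha>. sym_sum {g \<in> perms {1..n}. \<tau> g = \<alpha>}) ` partitions n)"
proof -
  let ?G = "perms {1..n}"
  have "\<exists>c. \<forall>g\<in>?G. \<tau> g = \<alpha> \<longrightarrow> coef x g = c" for \<alpha>
    using conj cls by (cases "\<exists>g\<in>?G. \<tau> g = \<alpha>") (metis, blast)
  then obtain c where c: "\<And>g. g \<in> ?G \<Longrightarrow> coef x g = c (\<tau> g)" by metis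
  have "x = (\<Sum>g\<in>?G. c (\<tau> g) *\<^sub>S \<delta> g)"
    using expand_delta_superset[of ?G x] x c by (simp add: supported_def)
  also have "\<dots> = (\<Sum>\<alpha>\<in>partitions n. \<Sum>g\<in>{g \<in> ?G. \<tau> g = \<alpha>}. c (\<tau> g) *\<^sub>S \<delta> g)"
    by (rule sum.group[symmetric]) (use n finite_partitions in auto)
  also have "\<dots> = (\<Sum>\<alpha>\<in>partitions n. c \<alpha> *\<^sub>S sym_sum {g \<in> ?G. \<tau> g = \<alpha>})"
    by (simp add: sym_sum_def GA.scale_sum_right)
  finally show ?thesis
    by (simp add: GA.span_sum GA.span_scale GA.span_base)
qed

text \<open>The class averages are as many independent elements as there are partitions, in the span
  of the class sums, which are at most as many. If 1 were not in the span of
  the class averages, adding it would give more independent elements than that span allows.\<close>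

lemma one_in_span_class_averages: "1 \<in> GA.span (class_average ` partitions n)"
proof (rule ccontr)
  assume contra: "1 \<notin> GA.span (class_average ` partitions n)"
  let ?P = "partitions n" and ?G = "perms {1..n}"
  have inj: "inj_on class_average ?P"
    by (rule inj_onI) (metis class_average_mult_class_average_eq_0 class_average_square_nonzero)
  have indep: "GA.independent (class_average ` ?P)"
  proof (rule GA.independent_if_scalars_zero)
    show "finite (class_average ` ?P)" by (simp add: finite_partitions)
    fix f y assume sum: "(\<Sum>x\<in>class_average ` ?P. f x *\<^sub>S x) = 0" and "y \<in> class_average ` ?P"
    then obtain \<mu> where \<mu>: "\<mu> \<in> ?P" "y = class_average \<mu>" by blast
    have "0 = (\<Sum>\<nu>\<in>?P. f (class_average \<nu>) *\<^sub>S class_average \<nu>) * class_average \<mu>"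
      using sum by (simp add: sum.reindex[OF inj])
    also have "\<dots> = (\<Sum>\<nu>\<in>?P. if \<nu> = \<mu> then f y *\<^sub>S (class_average \<mu> * class_average \<mu>) else 0)"
      unfolding sum_distrib_right
      using \<mu> by (intro sum.cong) (auto simp: scale_mult_left class_average_mult_class_average_eq_0)
    also have "\<dots> = f y *\<^sub>S (class_average \<mu> * class_average \<mu>)"
      using \<mu> finite_partitions by simp
    finally show "f y = 0"
      using class_average_square_nonzero[OF \<mu>(1)] by simp
  qed
  obtain \<tau> where \<tau>: "\<And>g. g \<in> ?G \<Longrightarrow> \<tau> g \<in> ?P"
    "\<And>g h. g \<in> ?G \<Longrightarrow> h \<in> ?G \<Longrightarrow> \<tau> g = \<tau> h \<Longrightarrow> \<exists>k\<in>?G. h = k + g - k"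
    using cycle_type_exists[of n] by blast
  define C where "C = (\<lambda>\<alpha>. sym_sum {g \<in> ?G. \<tau> g = \<alpha>}) ` ?P"
  have "class_average \<alpha> \<in> GA.span C" if "\<alpha> \<in> ?P" for \<alpha>
    unfolding C_def using that
    by (intro class_function_in_span[OF \<tau> supported_class_average coef_class_average_conjugate])
  moreover have "1 \<in> GA.span C"
    unfolding C_def
  proof (rule class_function_in_span[OF \<tau>])
    show "1 \<in> supported {1..n}"
      using supported_delta[OF perms_closed(1)] by simp
    show "coef 1 (k + g - k) = coef 1 g" for g k
    proof -
      have "k + g - k = 0 \<longleftrightarrow> g = 0"
        using add_left_cancel[of k g 0] by simp
      then show ?thesis by (simp add: lookup_one when_def)
    qed
  qed
  ultimately have sub: "insert 1 (class_average ` ?P) \<subseteq> GA.span C" by auto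
  have "card (insert 1 (class_average ` ?P)) = Suc (card ?P)"
    using contra GA.span_base finite_partitions card_image[OF inj] by (subst card_insert_disjoint) auto
  moreover have "card C \<le> card ?P" "finite C"
    unfolding C_def by (simp_all add: card_image_le finite_partitions)
  moreover have "GA.independent (insert 1 (class_average ` ?P))"
    using indep contra by (simp add: GA.independent_insert)
  ultimately show False
    using GA.independent_span_bound[OF _ _ sub] by auto
qed

theorem faithful_on_immaculate_vectors:
  assumes zero: "\<And>\<alpha> v. \<alpha> \<in> partitions n \<Longrightarrow> v \<in> immaculate_vectors \<alpha> \<Longrightarrow> x * v = 0"
  shows "x = 0"
proof -
  have sub: "GA.subspace {v. x * v = 0}"
    by (auto simp: GA.subspace_def distrib_left mult_scale_right)
  have "x * class_average \<alpha> = 0" if \<alpha>: "\<alpha> \<in> partitions n" for \<alpha>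
  proof -
    have "GA.span (immaculate_vectors \<alpha>) \<subseteq> {v. x * v = 0}"
      using zero[OF \<alpha>] by (intro GA.span_minimal sub) auto
    then have "x * (\<delta> g * young \<alpha>) = 0" if "g \<in> perms {1..n}" for g
      using straightening[OF \<alpha> that] by blast
    then show ?thesis
      by (simp add: class_average_eq[OF \<alpha>] sum_distrib_left mult.assoc[symmetric])
  qed
  then have "GA.span (class_average ` partitions n) \<subseteq> {v. x * v = 0}"
    by (intro GA.span_minimal sub) auto
  then show ?thesis
    using one_in_span_class_averages[of n] by auto
qed

section \<open>Matrix blocks\<close>

definition algebra_hom_to_mat :: "nat set \<Rightarrow> nat \<Rightarrow> (grpalg \<Rightarrow> complex mat) \<Rightarrow> bool" where
  "algebra_hom_to_mat X m M \<longleftrightarrow> (\<forall>x. M x \<in> carrier_mat m m) \<and>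
    (\<forall>x\<in>supported X. \<forall>y\<in>supported X. M (x + y) = M x + M y) \<and>
    (\<forall>x\<in>supported X. \<forall>y\<in>supported X. M (x * y) = M x * M y) \<and>
    (\<forall>c. \<forall>x\<in>supported X. M (c *\<^sub>S x) = c \<cdot>\<^sub>m M x)"

text \<open>The matrices describe the action by left multiplication on the span of \<open>V\<close> with
  respect to a basis \<open>B \<subseteq> V\<close>. The entries outside the upper left block of size \<open>card B\<close> are zero.\<close>

lemma matrix_representation:
  assumes V: "finite V" "card V \<le> m"
    and closed: "\<And>x v. x \<in> supported X \<Longrightarrow> v \<in> V \<Longrightarrow> x * v \<in> GA.span V"
  shows "\<exists>M. algebra_hom_to_mat X m M \<and>
    (\<forall>x\<in>supported X. \<forall>y\<in>supported X. M x = M y \<longrightarrow> (\<forall>v\<in>V. x * v = y * v))"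
proof -
  obtain B where B: "B \<subseteq> V" "GA.independent B" "V \<subseteq> GA.span B"
    by (rule GA.maximal_independent_subset)
  define k where "k = card B"
  have fin: "finite B" and km: "k \<le> m"
    using B V by (auto simp: k_def intro: finite_subset card_mono le_trans)
  obtain b where b: "bij_betw b {..<k} B"
    using ex_bij_betw_nat_finite[OF fin] by (auto simp: k_def lessThan_atLeast0)
  have bB: "b i \<in> B" if "i < k" for i
    using bij_betwE[OF b] that by simp
  let ?r = "GA.representation B"
  have span: "GA.span V = GA.span B"
    using B by (metis GA.span_mono GA.span_span subset_antisym)
  have in_span: "x * v \<in> GA.span B" if "x \<in> supported X" "v \<in> B" for x v
    using closed[of x v] that B(1) span by auto
  define M where "M x = mat m m (\<lambda>(i, j). if i < k \<and> j < k then ?r (x * b j) (b i) else 0)" for x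
  have M_mult: "M (x * y) = M x * M y" if x: "x \<in> supported X" and y: "y \<in> supported X" for x y
  proof (rule eq_matI)
    fix i j assume "i < dim_row (M x * M y)" "j < dim_col (M x * M y)"
    then have ij: "i < m" "j < m" by (simp_all add: M_def)
    have "(M x * M y) $$ (i, j) = (\<Sum>l<m. M x $$ (i, l) * M y $$ (l, j))"
      using ij by (simp add: M_def scalar_prod_def lessThan_atLeast0)
    also have "\<dots> = (\<Sum>l<k. M x $$ (i, l) * M y $$ (l, j))"
      using ij km by (intro sum.mono_neutral_right) (auto simp: M_def)
    also have "\<dots> = M (x * y) $$ (i, j)"
    proof (cases "i < k \<and> j < k")
      case True
      then have i: "i < k" and j: "j < k" by auto
      have "y * b j = (\<Sum>v\<in>B. ?r (y * b j) v *\<^sub>S v)"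
        by (rule GA.sum_representation_eq[symmetric]) (use B in_span[OF y bB[OF j]] fin in auto)
      also have "\<dots> = (\<Sum>l<k. ?r (y * b j) (b l) *\<^sub>S b l)"
        by (rule sum.reindex_bij_betw[OF b, symmetric])
      finally have "x * y * b j = x * (\<Sum>l<k. ?r (y * b j) (b l) *\<^sub>S b l)"
        by (simp add: mult.assoc)
      also have "\<dots> = (\<Sum>l<k. ?r (y * b j) (b l) *\<^sub>S (x * b l))"
        by (simp add: sum_distrib_left mult_scale_right)
      finally have "?r (x * y * b j) (b i) = ?r (\<Sum>l<k. ?r (y * b j) (b l) *\<^sub>S (x * b l)) (b i)"
        by simp
      also have "\<dots> = (\<Sum>l<k. ?r (?r (y * b j) (b l) *\<^sub>S (x * b l)) (b i))"
        using in_span[OF x bB]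
        by (subst GA.representation_sum[OF B(2)]) (auto intro!: GA.span_scale)
      also have "\<dots> = (\<Sum>l<k. ?r (y * b j) (b l) * ?r (x * b l) (b i))"
        using in_span[OF x bB]
        by (intro sum.cong refl) (simp add: GA.representation_scale[OF B(2)])
      finally have "?r (x * y * b j) (b i) = (\<Sum>l<k. ?r (y * b j) (b l) * ?r (x * b l) (b i))" .
      then show ?thesis
        using ij i j km by (simp add: M_def mult.commute)
    next
      case False
      then show ?thesis
        using ij km by (auto simp: M_def intro!: sum.neutral)
    qed
    finally show "M (x * y) $$ (i, j) = (M x * M y) $$ (i, j)" ..
  qed (simp_all add: M_def)
  have M_add: "M (x + y) = M x + M y" if "x \<in> supported X" "y \<in> supported X" for x y
    using in_span[OF that(1) bB] in_span[OF that(2) bB]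
    by (intro eq_matI) (auto simp: M_def distrib_right GA.representation_add[OF B(2)])
  have M_scale: "M (c *\<^sub>S x) = c \<cdot>\<^sub>m M x" if "x \<in> supported X" for c x
    using in_span[OF that bB]
    by (intro eq_matI) (auto simp: M_def scale_mult_left GA.representation_scale[OF B(2)])
  have M_inj: "x * v = y * v" if x: "x \<in> supported X" and y: "y \<in> supported X" and eq: "M x = M y" and v: "v \<in> V"
    for x y v
  proof -
    have on_B: "x * w = y * w" if w: "w \<in> B" for w
    proof -
      obtain j where j: "j < k" "w = b j"
        using w bij_betw_imp_surj_on[OF b] by auto
      have "?r (x * w) u = ?r (y * w) u" if u: "u \<in> B" for u
      proof -
        obtain i where i: "i < k" "u = b i"
          using u bij_betw_imp_surj_on[OF b] by auto
        show ?thesis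
          using arg_cong[OF eq, of "\<lambda>A. A $$ (i, j)"] i j km by (simp add: M_def)
      qed
      then have "(\<Sum>u\<in>B. ?r (x * w) u *\<^sub>S u) = (\<Sum>u\<in>B. ?r (y * w) u *\<^sub>S u)"
        by simp
      then show ?thesis
        using GA.sum_representation_eq[OF B(2) in_span[OF x w] fin] GA.sum_representation_eq[OF B(2) in_span[OF y w] fin]
        by simp
    qed
    have "GA.subspace {v. x * v = y * v}"
      by (auto simp: GA.subspace_def distrib_left mult_scale_right)
    then have "GA.span B \<subseteq> {v. x * v = y * v}"
      using on_B by (intro GA.span_minimal) auto
    then show ?thesis using v B(3) by blast
  qed
  have "algebra_hom_to_mat X m M"
    unfolding algebra_hom_to_mat_def using M_mult M_add M_scale by (simp add: M_def)
  then show ?thesis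
    using M_inj by blast
qed

text \<open>The zero map serves compositions that are not partitions.\<close>

lemma immaculate_block:
  assumes "\<alpha> \<in> compositions n"
  shows "\<exists>M. algebra_hom_to_mat {1..n} (immaculate_number \<alpha>) M \<and>
    (\<alpha> \<in> partitions n \<longrightarrow> (\<forall>x\<in>supported {1..n}. \<forall>y\<in>supported {1..n}.
       M x = M y \<longrightarrow> (\<forall>v\<in>immaculate_vectors \<alpha>. x * v = y * v)))"
proof (cases "\<alpha> \<in> partitions n")
  case \<alpha>: True
  have "x * v \<in> GA.span (immaculate_vectors \<alpha>)"
    if x: "x \<in> supported {1..n}" and v: "v \<in> immaculate_vectors \<alpha>" for x v
  proof -
    obtain h where h: "h \<in> perms {1..n}" "v = \<delta> h * young \<alpha>"
      using v assms by (auto simp: immaculate_vectors_def compositions_def)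
    have "x * v = (\<Sum>g\<in>perms {1..n}. coef x g *\<^sub>S (\<delta> (g + h) * young \<alpha>))"
      using x by (subst expand_delta_superset[of "perms {1..n}" x])
        (auto simp: supported_def h sum_distrib_right scale_mult_left delta_mult_assoc)
    then show ?thesis
      using straightening[OF \<alpha>] h by (simp add: GA.span_sum GA.span_scale)
  qed
  from matrix_representation[OF finite_immaculate_vectors card_immaculate_vectors this] \<alpha>
  show ?thesis
    by simp
next
  case False
  let ?m = "immaculate_number \<alpha>"
  have "algebra_hom_to_mat {1..n} ?m (\<lambda>_. 0\<^sub>m ?m ?m)"
    by (simp add: algebra_hom_to_mat_def)
  with False show ?thesis
    by (intro exI[of _ "\<lambda>_. 0\<^sub>m ?m ?m"]) simp
qed

section \<open>Transfer to the group algebra of the symmetric group\<close>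

lemma carrier_group_algebra_sym:
  "carrier (group_algebra (sym_group n)) = {a. \<forall>p. a p \<noteq> 0 \<longrightarrow> p permutes {1..n}}"
proof -
  have "finite {p. a p \<noteq> 0}" if "\<forall>p. a p \<noteq> 0 \<longrightarrow> p permutes {1..n}" for a :: "(nat \<Rightarrow> nat) \<Rightarrow> complex"
    by (rule finite_subset[OF _ finite_permutations[of "{1..n}"]]) (use that in auto)
  then show ?thesis
    by (auto simp: group_algebra_def sym_group_def)
qed

lemma group_algebra_sym_mult_closed:
  assumes a: "a \<in> carrier (group_algebra (sym_group n))" and b: "b \<in> carrier (group_algebra (sym_group n))"
  shows "a \<otimes>\<^bsub>group_algebra (sym_group n)\<^esub> b \<in> carrier (group_algebra (sym_group n))"
proof -
  have "p permutes {1..n}" if p: "(a \<otimes>\<^bsub>group_algebra (sym_group n)\<^esub> b) p \<noteq> 0" for p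
  proof -
    have "{(g, h). a g \<noteq> 0 \<and> b h \<noteq> 0 \<and> g \<circ> h = p} \<noteq> {}"
    proof
      assume "{(g, h). a g \<noteq> 0 \<and> b h \<noteq> 0 \<and> g \<circ> h = p} = {}"
      with p show False
        by (simp only: group_algebra_def monoid.simps ring.simps module.simps sym_group_mult sum.empty)
    qed
    then obtain g h where "a g \<noteq> 0" "b h \<noteq> 0" "p = g \<circ> h" by auto
    then show ?thesis
      using a b by (auto simp: carrier_group_algebra_sym intro!: permutes_compose)
  qed
  then show ?thesis
    by (simp add: carrier_group_algebra_sym)
qed

definition perm_alg :: "nat \<Rightarrow> ((nat \<Rightarrow> nat) \<Rightarrow> complex) \<Rightarrow> grpalg" where
  "perm_alg n a = (\<Sum>g\<in>perms {1..n}. a (act g) *\<^sub>S \<delta> g)"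

lemma perm_alg_supported: "perm_alg n a \<in> supported {1..n}"
  unfolding perm_alg_def by (intro supported_sum supported_scale supported_delta)

lemma coef_perm_alg: "coef (perm_alg n a) g = (if g \<in> perms {1..n} then a (act g) else 0)"
proof -
  have "coef (perm_alg n a) g = (\<Sum>h\<in>perms {1..n}. a (act h) * (if h = g then 1 else 0))"
    by (simp add: perm_alg_def lookup_sum lookup_single when_def)
  also have "\<dots> = (\<Sum>h\<in>perms {1..n}. if h = g then a (act g) else 0)"
    by (intro sum.cong) auto
  finally show ?thesis by simp
qed

lemma perm_alg_inj:
  assumes "a \<in> carrier (group_algebra (sym_group n))" "b \<in> carrier (group_algebra (sym_group n))"
    and "perm_alg n a = perm_alg n b"
  shows "a = b"
proof
  fix p
  show "a p = b p"
  proof (cases "p permutes {1..n}")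
    case True
    then show ?thesis
      using arg_cong[OF assms(3), of "\<lambda>x. coef x (Perm p)"] Perm_in_perms[OF True]
      by (simp add: coef_perm_alg permutes_bij)
  next
    case False
    then show ?thesis
      using assms(1,2) unfolding carrier_group_algebra_sym mem_Collect_eq by metis
  qed
qed

lemma perm_alg_mult:
  assumes a: "a \<in> carrier (group_algebra (sym_group n))" and b: "b \<in> carrier (group_algebra (sym_group n))"
  shows "perm_alg n (a \<otimes>\<^bsub>group_algebra (sym_group n)\<^esub> b) = perm_alg n a * perm_alg n b"
proof (rule poly_mapping_eqI)
  fix k
  let ?G = "sym_group n"
  have fin: "finite (carrier ?G)"
    by (simp add: sym_group_def finite_permutations)
  have inv: "inv\<^bsub>?G\<^esub> (act g) = inv' (act g)" if "g \<in> perms {1..n}" for g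
    using that by (intro sym_group_inv_equality) (auto simp: sym_group_carrier perms_def)
  have mult: "coef (perm_alg n a * perm_alg n b) k =
      (\<Sum>g\<in>perms {1..n}. a (act g) * coef (perm_alg n b) (- g + k))"
    by (subst coef_mult[OF _ perm_alg_supported]) (simp_all add: coef_perm_alg)
  show "coef (perm_alg n (a \<otimes>\<^bsub>group_algebra ?G\<^esub> b)) k = coef (perm_alg n a * perm_alg n b) k"
  proof (cases "k \<in> perms {1..n}")
    case True
    then have "(a \<otimes>\<^bsub>group_algebra ?G\<^esub> b) (act k) =
        (\<Sum>p\<in>carrier ?G. a p * b (inv\<^bsub>?G\<^esub> p \<otimes>\<^bsub>?G\<^esub> act k))"
      by (intro group_algebra_mult_eq_convolution sym_group_is_group fin a b)
        (simp add: sym_group_def perms_def)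
    also have "\<dots> = (\<Sum>g\<in>perms {1..n}. a (act g) * b (inv\<^bsub>?G\<^esub> (act g) \<otimes>\<^bsub>?G\<^esub> act k))"
      using sum.reindex_bij_betw[OF bij_betw_act_perms[of "{1..n}"], symmetric]
      by (simp add: sym_group_def)
    also have "\<dots> = (\<Sum>g\<in>perms {1..n}. a (act g) * coef (perm_alg n b) (- g + k))"
      using True by (intro sum.cong refl) (simp add: inv sym_group_mult coef_perm_alg)
    finally show ?thesis
      using True by (simp add: mult coef_perm_alg)
  next
    case False
    have "- g + k \<notin> perms {1..n}" if "g \<in> perms {1..n}" for g
      using perms_closed(2)[OF that, of "- g + k"] False by (auto simp: add.assoc[symmetric])
    then show ?thesis
      using False by (simp add: mult coef_perm_alg)
  qed
qed

theorem theorem4: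
  fixes n :: nat
  assumes "0 < n"
  shows "\<exists>S. subalgebra S (immaculate_algebra n) \<and>
             algebra_isomorphic (group_algebra (sym_group n)) ((immaculate_algebra n)\<lparr>carrier := S\<rparr>)"
proof -
  let ?A = "group_algebra (sym_group n)" and ?B = "immaculate_algebra n" and ?C = "compositions n"
    and ?U = "supported {1..n}"
  have "\<forall>\<alpha>\<in>?C. \<exists>M. algebra_hom_to_mat {1..n} (immaculate_number \<alpha>) M \<and>
    (\<alpha> \<in> partitions n \<longrightarrow> (\<forall>x\<in>?U. \<forall>y\<in>?U. M x = M y \<longrightarrow> (\<forall>v\<in>immaculate_vectors \<alpha>. x * v = y * v)))"
    by (intro ballI immaculate_block)
  from bchoice[OF this] obtain M where
    M: "\<And>\<alpha>. \<alpha> \<in> ?C \<Longrightarrow> algebra_hom_to_mat {1..n} (immaculate_number \<alpha>) (M \<alpha>)"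
    and M_inj: "\<And>\<alpha> x y v. \<alpha> \<in> partitions n \<Longrightarrow> \<alpha> \<in> ?C \<Longrightarrow> x \<in> ?U \<Longrightarrow> y \<in> ?U \<Longrightarrow> M \<alpha> x = M \<alpha> y \<Longrightarrow>
      v \<in> immaculate_vectors \<alpha> \<Longrightarrow> x * v = y * v"
    by blast
  have M_carrier: "M \<alpha> x \<in> carrier_mat (immaculate_number \<alpha>) (immaculate_number \<alpha>)"
    if "\<alpha> \<in> ?C" for \<alpha> x
    using M[OF that] by (simp add: algebra_hom_to_mat_def)
  have M_add: "M \<alpha> (x + y) = M \<alpha> x + M \<alpha> y" and M_mult: "M \<alpha> (x * y) = M \<alpha> x * M \<alpha> y"
    if "\<alpha> \<in> ?C" "x \<in> ?U" "y \<in> ?U" for \<alpha> x y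
    using M[OF that(1)] that(2,3) by (simp_all add: algebra_hom_to_mat_def)
  have M_scale: "M \<alpha> (c *\<^sub>S x) = c \<cdot>\<^sub>m M \<alpha> x" if "\<alpha> \<in> ?C" "x \<in> ?U" for \<alpha> x c
    using M[OF that(1)] that(2) by (simp add: algebra_hom_to_mat_def)
  define f where "f a = (\<lambda>\<alpha>\<in>?C. M \<alpha> (perm_alg n a))" for a
  note simps = immaculate_algebra_def algebra_direct_sum_def module_mat_def
  have f_add: "f (a \<oplus>\<^bsub>?A\<^esub> b) = f a \<oplus>\<^bsub>?B\<^esub> f b" for a b
  proof -
    have "perm_alg n (a \<oplus>\<^bsub>?A\<^esub> b) = perm_alg n a + perm_alg n b"
      by (simp add: perm_alg_def group_algebra_def GA.scale_left_distrib sum.distrib)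
    then show ?thesis
      by (auto simp: f_def simps M_add perm_alg_supported simp del: One_nat_def intro!: restrict_ext)
  qed
  have f_mult: "f (a \<otimes>\<^bsub>?A\<^esub> b) = f a \<otimes>\<^bsub>?B\<^esub> f b" if "a \<in> carrier ?A" "b \<in> carrier ?A" for a b
    using perm_alg_mult[OF that]
    by (auto simp: f_def simps M_mult perm_alg_supported simp del: One_nat_def intro!: restrict_ext)
  have f_smult: "f (c \<odot>\<^bsub>?A\<^esub> a) = c \<odot>\<^bsub>?B\<^esub> f a" for c a
  proof -
    have "perm_alg n (c \<odot>\<^bsub>?A\<^esub> a) = c *\<^sub>S perm_alg n a"
      by (simp add: perm_alg_def group_algebra_def GA.scale_sum_right)
    then show ?thesis
      by (auto simp: f_def simps M_scale perm_alg_supported simp del: One_nat_def intro!: restrict_ext)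
  qed
  have "inj_on f (carrier ?A)"
  proof (rule inj_onI)
    fix a b assume ab: "a \<in> carrier ?A" "b \<in> carrier ?A" "f a = f b"
    have "(perm_alg n a - perm_alg n b) * v = 0"
      if "\<alpha> \<in> partitions n" "v \<in> immaculate_vectors \<alpha>" for \<alpha> v
    proof -
      have \<alpha>: "\<alpha> \<in> ?C" using that by (simp add: partition_composition)
      then have "M \<alpha> (perm_alg n a) = M \<alpha> (perm_alg n b)"
        using fun_cong[OF ab(3), of \<alpha>] by (simp add: f_def)
      then have "perm_alg n a * v = perm_alg n b * v"
        by (rule M_inj[OF that(1) \<alpha> perm_alg_supported perm_alg_supported _ that(2)])
      then show ?thesis
        by (simp add: left_diff_distrib)
    qed
    then have "perm_alg n a - perm_alg n b = 0"
      by (rule faithful_on_immaculate_vectors)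
    then show "a = b"
      using ab by (intro perm_alg_inj) auto
  qed
  have add_closed: "a \<oplus>\<^bsub>?A\<^esub> b \<in> carrier ?A" if "a \<in> carrier ?A" "b \<in> carrier ?A" for a b
  proof -
    have "a p + b p \<noteq> 0 \<Longrightarrow> a p \<noteq> 0 \<or> b p \<noteq> 0" for p by auto
    then show ?thesis
      using that unfolding carrier_group_algebra_sym mem_Collect_eq by (simp add: group_algebra_def) blast
  qed
  have smult_closed: "c \<odot>\<^bsub>?A\<^esub> a \<in> carrier ?A" if "a \<in> carrier ?A" for a c
    using that unfolding carrier_group_algebra_sym mem_Collect_eq by (simp add: group_algebra_def)
  let ?S = "f ` carrier ?A"
  have zero: "(\<lambda>_. 0) \<in> carrier ?A"
    by (simp add: carrier_group_algebra_sym)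
  have f_zero: "f (\<lambda>_. 0) = \<zero>\<^bsub>?B\<^esub>"
  proof -
    have "perm_alg n (\<lambda>_. 0) = 0"
      by (simp add: perm_alg_def)
    moreover have "M \<alpha> 0 = 0\<^sub>m (immaculate_number \<alpha>) (immaculate_number \<alpha>)" if "\<alpha> \<in> ?C" for \<alpha>
    proof -
      have "M \<alpha> 0 = 0 \<cdot>\<^sub>m M \<alpha> 0"
        using M_scale[OF that, of 0 0] by (simp add: supported_def)
      also have "\<dots> = 0\<^sub>m (immaculate_number \<alpha>) (immaculate_number \<alpha>)"
        using M_carrier[OF that, of 0] by (intro eq_matI) auto
      finally show ?thesis .
    qed
    ultimately show ?thesis
      by (auto simp: f_def simps intro!: restrict_ext)
  qed
  have "submodule class_ring ?S ?B"
  proof (rule submodule.intro)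
    show "?S \<subseteq> carrier ?B"
      using M_carrier by (auto simp: f_def simps)
    show "\<zero>\<^bsub>?B\<^esub> \<in> ?S"
      using zero f_zero by (metis imageI)
    show "u \<oplus>\<^bsub>?B\<^esub> v \<in> ?S" if "u \<in> ?S" "v \<in> ?S" for u v
      using that add_closed by (auto simp: f_add[symmetric])
    show "c \<odot>\<^bsub>?B\<^esub> u \<in> ?S" if "c \<in> carrier class_ring" "u \<in> ?S" for c u
      using that smult_closed by (auto simp: f_smult[symmetric])
  qed (use vectorspace_immaculate_algebra[of n] in \<open>simp add: vectorspace_def\<close>)
  then have "VectorSpace.subspace class_ring ?S ?B"
    by (intro VectorSpace.subspace.intro vectorspace_immaculate_algebra)
  moreover have "u \<otimes>\<^bsub>?B\<^esub> v \<in> ?S" if "u \<in> ?S" "v \<in> ?S" for u v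
    using that group_algebra_sym_mult_closed by (auto simp: f_mult[symmetric])
  ultimately have "subalgebra ?S ?B"
    by (simp add: subalgebra_def)
  moreover have "algebra_isomorphic ?A (?B\<lparr>carrier := ?S\<rparr>)"
    unfolding algebra_isomorphic_def
    using \<open>inj_on f (carrier ?A)\<close> f_mult
    by (intro exI[of _ f]) (simp add: bij_betw_def f_add f_smult)
  ultimately show ?thesis by blast
qed

end
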